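(* Let $Y$ be a smooth manifold, $i\geq 1$, and $G_{2i}\in\Omega^{2i}(Y)$. The de Rham complex can be twisted by a differential of the form $$d+v_{2i-1}\,G_{2i}\wedge ,$$ i.e. this operator squares to zero, provided that $G_{2i}$ is closed and $v_{2i-1}$ is Grassmann algebra-valued.
   Context: $v_{2i-1}$ is a constant ($dv_{2i-1}=0$) odd element of a Grassmann (exterior) algebra $R$ over $\mathbb{R}$, so that $v_{2i-1}^2=0$; the sign rule is $d(v_{2i-1}\alpha)=-v_{2i-1}\,d\alpha$ for every $\alpha$, and $v_{2i-1}$ commutes with even-degree differential forms. The operator acts on $\Omega^\bullet(Y)\otimes R$. *)

theory Defs
  imports "HOL-Analysis.Analysis"
begin

section \<open>Smooth maps\<close>

text \<open>
  \<open>Ck_on n S f\<close>: all iterated directional derivatives of \<open>f\<close> up to order \<open>n\<close> exist as Frechet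
  derivatives and are continuous. For open \<open>S\<close> in a finite-dimensional space this is the class
  \<open>C\<^sup>n\<close>; it is used for open \<open>S\<close> only.
\<close>

primrec Ck_on :: "nat \<Rightarrow> 'a::real_normed_vector set \<Rightarrow> ('a \<Rightarrow> 'b::real_normed_vector) \<Rightarrow> bool"
where
  "Ck_on 0 S f \<longleftrightarrow> continuous_on S f"
| "Ck_on (Suc n) S f \<longleftrightarrow>
     (\<forall>x\<in>S. f differentiable (at x)) \<and> (\<forall>h. Ck_on n S (\<lambda>x. frechet_derivative f (at x) h))"

definition smooth_on :: "'a::real_normed_vector set \<Rightarrow> ('a \<Rightarrow> 'b::real_normed_vector) \<Rightarrow> bool" where
  "smooth_on S f \<longleftrightarrow> (\<forall>n. Ck_on n S f)"


section \<open>Smooth manifolds\<close>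

text \<open>
  A chart \<open>(U, \<phi>)\<close> maps \<open>U\<close> homeomorphically onto an open subset of the model space \<open>'e\<close>. The
  model space is a finite-dimensional normed space; the class \<open>euclidean_space\<close> would exclude
  dimension zero.
\<close>

type_synonym ('a, 'e) chart = "'a set \<times> ('a \<Rightarrow> 'e)"

definition chart_image :: "('a, 'e) chart \<Rightarrow> 'e set" where
  "chart_image c = snd c ` fst c"

definition is_chart :: "'a topology \<Rightarrow> ('a, 'e::real_normed_vector) chart \<Rightarrow> bool" where
  "is_chart Y c \<longleftrightarrow>
     openin Y (fst c) \<and> open (chart_image c) \<and>
     homeomorphic_map (subtopology Y (fst c)) (top_of_set (chart_image c)) (snd c)"

definition overlap :: "('a, 'e) chart \<Rightarrow> ('a, 'e) chart \<Rightarrow> 'e set" where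
  "overlap c c' = snd c ` (fst c \<inter> fst c')"

definition transition :: "('a, 'e) chart \<Rightarrow> ('a, 'e) chart \<Rightarrow> 'e \<Rightarrow> 'e" where
  "transition c c' = snd c' \<circ> inv_into (fst c) (snd c)"

text \<open>
  The smooth structure is given by a smooth atlas \<open>\<A>\<close>, not required to be maximal.
\<close>

definition smooth_manifold :: "'a topology \<Rightarrow> ('a, 'e::real_normed_vector) chart set \<Rightarrow> bool" where
  "smooth_manifold Y \<A> \<longleftrightarrow>
     (\<exists>B::'e set. finite B \<and> span B = UNIV) \<and>
     Hausdorff_space Y \<and> second_countable Y \<and>
     (\<forall>c\<in>\<A>. is_chart Y c) \<and> (\<Union>c\<in>\<A>. fst c) = topspace Y \<and>
     (\<forall>c\<in>\<A>. \<forall>c'\<in>\<A>. smooth_on (overlap c c') (transition c c'))"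


section \<open>Differential forms\<close>

text \<open>
  Alternating \<open>k\<close>-linear forms. The arguments are the values \<open>v 0, \<dots>, v (k - 1)\<close> of a sequence
  \<open>v\<close>; the first condition says that the remaining values are ignored.
\<close>

definition alternating_forms :: "nat \<Rightarrow> ((nat \<Rightarrow> 'e::real_vector) \<Rightarrow> real) set" where
  "alternating_forms k =
     {f. (\<forall>v w. (\<forall>i<k. v i = w i) \<longrightarrow> f v = f w) \<and>
         (\<forall>v. \<forall>i<k. linear (\<lambda>u. f (v(i := u)))) \<and>
         (\<forall>v. \<forall>i<k. \<forall>j<k. i \<noteq> j \<longrightarrow> v i = v j \<longrightarrow> f v = 0)}"

text \<open>
  A differential form on the manifold is a family of smooth forms, one on the image of each chart,
  which correspond to each other under pullback along the transition maps. The value at an index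
  that is not a chart of the atlas, or at a point outside the image of the chart, is fixed to be
  \<open>0\<close>, so that equality of forms is equality of functions.
\<close>

type_synonym ('a, 'e) dform = "('a, 'e) chart \<Rightarrow> 'e \<Rightarrow> (nat \<Rightarrow> 'e) \<Rightarrow> real"

definition zero_form :: "('a, 'e) dform" where
  "zero_form = (\<lambda>c x v. 0)"

definition forms :: "('a, 'e::real_normed_vector) chart set \<Rightarrow> nat \<Rightarrow> ('a, 'e) dform set" where
  "forms \<A> k =
     {\<omega>. (\<forall>c x. c \<notin> \<A> \<or> x \<notin> chart_image c \<longrightarrow> \<omega> c x = (\<lambda>v. 0)) \<and>
         (\<forall>c\<in>\<A>. \<forall>x\<in>chart_image c. \<omega> c x \<in> alternating_forms k) \<and>
         (\<forall>c\<in>\<A>. \<forall>v. smooth_on (chart_image c) (\<lambda>x. \<omega> c x v)) \<and>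
         (\<forall>c\<in>\<A>. \<forall>c'\<in>\<A>. \<forall>x\<in>overlap c c'. \<forall>v.
            \<omega> c x v =
            \<omega> c' (transition c c' x) (\<lambda>i. frechet_derivative (transition c c') (at x) (v i)))}"

definition const_form :: "('a, 'e) chart set \<Rightarrow> real \<Rightarrow> ('a, 'e) dform" where
  "const_form \<A> a = (\<lambda>c x v. if c \<in> \<A> \<and> x \<in> chart_image c then a else 0)"

text \<open>
  The factor \<open>1 / (p! q!)\<close> makes this the sum over \<open>(p, q)\<close>-shuffles; with this convention
  \<open>ext_deriv\<close> below carries no factor.
\<close>

definition wedge :: "nat \<Rightarrow> nat \<Rightarrow> ('a, 'e) dform \<Rightarrow> ('a, 'e) dform \<Rightarrow> ('a, 'e) dform" where
  "wedge p q \<alpha> \<beta> = (\<lambda>c x v.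
     (\<Sum>\<sigma> | \<sigma> permutes {..<p + q}.
        of_int (sign \<sigma>) * \<alpha> c x (\<lambda>i. v (\<sigma> i)) * \<beta> c x (\<lambda>i. v (\<sigma> (p + i)))) / (fact p * fact q))"

definition omit :: "nat \<Rightarrow> (nat \<Rightarrow> 'e) \<Rightarrow> nat \<Rightarrow> 'e" where
  "omit i v = (\<lambda>j. if j < i then v j else v (Suc j))"

text \<open>
  The exterior derivative of a \<open>k\<close>-form. In a chart the arguments are constant vector fields,
  whose Lie brackets vanish.
\<close>

definition ext_deriv ::
  "('a, 'e::real_normed_vector) chart set \<Rightarrow> nat \<Rightarrow> ('a, 'e) dform \<Rightarrow> ('a, 'e) dform" where
  "ext_deriv \<A> k \<omega> = (\<lambda>c x v.
     if c \<in> \<A> \<and> x \<in> chart_image c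
     then \<Sum>i\<le>k. (- 1) ^ i * frechet_derivative (\<lambda>y. \<omega> c y (omit i v)) (at x) (v i)
     else 0)"


section \<open>Grassmann algebras\<close>

text \<open>
  The Grassmann algebra over \<open>\<real>\<close> on a set \<open>S\<close> of anticommuting generators \<open>\<theta> s\<close>. For finite
  \<open>A \<subseteq> S\<close> let \<open>\<theta> A\<close> be the product of the \<open>\<theta> s\<close> with \<open>s \<in> A\<close> in increasing order; these form a
  basis, and an element is represented by its coefficients. For disjoint \<open>A\<close>, \<open>B\<close> one has
  \<open>\<theta> A * \<theta> B = reorder_sign A B *\<^sub>R \<theta> (A \<union> B)\<close>, and the product is \<open>0\<close> if \<open>A\<close> and \<open>B\<close> meet.
\<close>

definition grassmann :: "'g set \<Rightarrow> ('g set \<Rightarrow> real) set" where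
  "grassmann S = {r. finite {A. r A \<noteq> 0} \<and> (\<forall>A. r A \<noteq> 0 \<longrightarrow> finite A \<and> A \<subseteq> S)}"

definition grassmann_odd :: "('g set \<Rightarrow> real) \<Rightarrow> bool" where
  "grassmann_odd r \<longleftrightarrow> (\<forall>A. r A \<noteq> 0 \<longrightarrow> odd (card A))"

definition reorder_sign :: "'g::linorder set \<Rightarrow> 'g set \<Rightarrow> real" where
  "reorder_sign A B = (- 1) ^ card {(a, b). a \<in> A \<and> b \<in> B \<and> b < a}"


section \<open>Grassmann algebra-valued differential forms\<close>

text \<open>
  The tensor product of the graded algebra of differential forms with the Grassmann algebra on
  \<open>S\<close>. The element \<open>\<Phi>\<close> stands for the finite sum of the \<open>\<Phi> A n \<otimes> \<theta> A\<close>, where \<open>\<Phi> A n\<close> is an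
  \<open>n\<close>-form.
\<close>

type_synonym ('a, 'e, 'g) gform = "'g set \<Rightarrow> nat \<Rightarrow> ('a, 'e) dform"

definition gforms ::
  "('a, 'e::real_normed_vector) chart set \<Rightarrow> 'g set \<Rightarrow> ('a, 'e, 'g) gform set" where
  "gforms \<A> S =
     {\<Phi>. (\<forall>A n. \<Phi> A n \<in> forms \<A> n) \<and>
         finite {(A, n). \<Phi> A n \<noteq> zero_form} \<and>
         (\<forall>A n. \<Phi> A n \<noteq> zero_form \<longrightarrow> finite A \<and> A \<subseteq> S)}"

definition gzero :: "('a, 'e, 'g) gform" where
  "gzero = (\<lambda>A n. zero_form)"

definition gadd :: "('a, 'e, 'g) gform \<Rightarrow> ('a, 'e, 'g) gform \<Rightarrow> ('a, 'e, 'g) gform" where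
  "gadd \<Phi> \<Psi> = (\<lambda>A n c x v. \<Phi> A n c x v + \<Psi> A n c x v)"

text \<open>
  The product follows the sign rule
  \<open>(\<alpha> \<otimes> \<theta> A) * (\<beta> \<otimes> \<theta> B) = (- 1) ^ (card A * q) *\<^sub>R (\<alpha> \<and> \<beta>) \<otimes> (\<theta> A * \<theta> B)\<close> for a \<open>q\<close>-form \<open>\<beta>\<close>.
\<close>

definition gmult ::
  "('a, 'e, 'g::linorder) gform \<Rightarrow> ('a, 'e, 'g) gform \<Rightarrow> ('a, 'e, 'g) gform" where
  "gmult \<Phi> \<Psi> = (\<lambda>C n c x v.
     \<Sum>A\<in>Pow C. \<Sum>p\<le>n.
       (- 1) ^ (card A * (n - p)) * reorder_sign A (C - A) *
       wedge p (n - p) (\<Phi> A p) (\<Psi> (C - A) (n - p)) c x v)"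

text \<open>
  The embeddings \<open>\<omega> \<mapsto> \<omega> \<otimes> 1\<close> of the \<open>k\<close>-forms and \<open>r \<mapsto> 1 \<otimes> r\<close> of the Grassmann algebra.
\<close>

definition of_form :: "nat \<Rightarrow> ('a, 'e) dform \<Rightarrow> ('a, 'e, 'g) gform" where
  "of_form k \<omega> = (\<lambda>A n. if A = {} \<and> n = k then \<omega> else zero_form)"

definition of_grassmann ::
  "('a, 'e) chart set \<Rightarrow> ('g set \<Rightarrow> real) \<Rightarrow> ('a, 'e, 'g) gform" where
  "of_grassmann \<A> r = (\<lambda>A n. if n = 0 then const_form \<A> (r A) else zero_form)"

text \<open>
  The de Rham differential \<open>\<omega> \<otimes> r \<mapsto> d \<omega> \<otimes> r\<close>. Elements of the Grassmann algebra are constant,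
  and with the sign rule of the product an odd \<open>r\<close> satisfies \<open>d (r * \<Phi>) = - r * d \<Phi>\<close>.
\<close>

definition de_rham ::
  "('a, 'e::real_normed_vector) chart set \<Rightarrow> ('a, 'e, 'g) gform \<Rightarrow> ('a, 'e, 'g) gform" where
  "de_rham \<A> \<Phi> = (\<lambda>A n. case n of 0 \<Rightarrow> zero_form | Suc k \<Rightarrow> ext_deriv \<A> k (\<Phi> A k))"

definition twisted_de_rham ::
  "('a, 'e::real_normed_vector) chart set \<Rightarrow> ('g::linorder set \<Rightarrow> real) \<Rightarrow> nat \<Rightarrow> ('a, 'e) dform \<Rightarrow>
   ('a, 'e, 'g) gform \<Rightarrow> ('a, 'e, 'g) gform" where
  "twisted_de_rham \<A> r k G \<Phi> =
     gadd (de_rham \<A> \<Phi>) (gmult (gmult (of_grassmann \<A> r) (of_form k G)) \<Phi>)"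

end

theory Submission
  imports Defs
begin

text \<open>
  Expanding \<open>(d + v G)\<^sup>2\<close> gives \<open>d\<^sup>2\<close>, the anticommutator of \<open>d\<close> with multiplication by \<open>v G\<close>, and the
  square of that multiplication. The first vanishes because second derivatives are symmetric, the
  second by the Leibniz rule since \<open>G\<close> is closed and of even degree and \<open>v\<close> is constant and odd.
  The coefficients of the third are sums over pairs of disjoint sets of generators \<open>A\<close>, \<open>B\<close>, whose terms
  change sign when \<open>A\<close> and \<open>B\<close> are exchanged; this works term by term with the iterated product
  \<open>G \<and> (G \<and> \<Phi>)\<close>, so associativity of the wedge product is not needed.

  Wedge product and exterior derivative are both antisymmetrizations of explicit expressions.
  This reduces the Leibniz rule to reindexing by cycles, and \<open>d\<^sup>2 = 0\<close> and the compatibility of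
  \<open>d\<close> with changes of charts to the fact that the antisymmetrization of an expression symmetric in two of
  its arguments vanishes.
\<close>

section \<open>Coordinates in finite-dimensional normed spaces\<close>

text \<open>The model space is merely a normed space with some finite spanning set, and smoothness
  is tested one direction at a time. Bounded coordinate functionals therefore carry the analysis.
  They serve twice: for the symmetry of second derivatives of transition maps, whose values are
  vectors, and for differentiating a form whose arguments vary with the point, as those of a
  pullback do.

  \<open>alt\<close> acts on arbitrary functions of the argument tuple, so the explicit expressions
  need not be alternating themselves. Sorting the permutations by the vector they put in slot 0
  yields exactly the signed sum of \<open>ext_deriv\<close>; if the expression is alternating in the
  other k slots, each group consists of k! equal terms, which is where the factorials come from.

  The anticommutation comes down to one sign. For odd \<open>r\<close> and even \<open>k\<close> the
  sign rule leaves the factor (-1)^n, where n is the form degree of the product, and d raises n by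
  one.\<close>

lemma closed_span_if_bounded_coordinates:
  fixes B :: "'e::real_normed_vector set"
  assumes "finite B" and K: "\<And>c b. b \<in> B \<Longrightarrow> \<bar>c b\<bar> \<le> K * norm (\<Sum>b\<in>B. c b *\<^sub>R b)"
  shows "closed (span B)"
proof -
  \<comment> \<open>Along a convergent sequence in the span the bound makes every coordinate
    sequence Cauchy, hence convergent in the reals, and the limits are coordinates of
    \<open>l\<close>.\<close>
  have "l \<in> span B" if "\<And>n. x n \<in> span B" and lim: "x \<longlonglongrightarrow> l" for x :: "nat \<Rightarrow> 'e" and l
  proof -
    have "\<forall>n. \<exists>c. x n = (\<Sum>b\<in>B. c b *\<^sub>R b)"
      using that(1) unfolding span_finite[OF assms(1)] by blast
    then obtain c where c: "\<And>n. x n = (\<Sum>b\<in>B. c n b *\<^sub>R b)"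
      by metis
    have "Cauchy x"
      using lim by (rule LIMSEQ_imp_Cauchy)
    have "convergent (\<lambda>n. c n b)" if "b \<in> B" for b
    proof -
      have "Cauchy (\<lambda>n. c n b)"
        unfolding Cauchy_iff
      proof (intro allI impI)
        fix e :: real
        assume "e > 0"
        \<comment> \<open>\<open>K\<close> may be 0 or negative, so |K| + 1 takes its place as a
          divisor.\<close>
        then have "e / (\<bar>K\<bar> + 1) > 0" by simp
        then obtain M where M: "\<And>m n. m \<ge> M \<Longrightarrow> n \<ge> M \<Longrightarrow> norm (x m - x n) < e / (\<bar>K\<bar> + 1)"
          using \<open>Cauchy x\<close> unfolding Cauchy_iff by blast
        have "norm (c m b - c n b) < e" if "m \<ge> M" "n \<ge> M" for m n
        proof -
          have "\<bar>c m b - c n b\<bar> \<le> K * norm (x m - x n)"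
            using K[OF \<open>b \<in> B\<close>, of "\<lambda>b. c m b - c n b"]
            by (simp add: c scaleR_left_diff_distrib sum_subtractf)
          also have "\<dots> \<le> (\<bar>K\<bar> + 1) * norm (x m - x n)"
            by (rule mult_right_mono) auto
          also have "\<dots> < e"
            using M[OF that] by (simp add: pos_less_divide_eq mult.commute)
          finally show ?thesis by simp
        qed
        then show "\<exists>M. \<forall>m\<ge>M. \<forall>n\<ge>M. norm (c m b - c n b) < e" by blast
      qed
      then show ?thesis by (simp add: Cauchy_convergent_iff)
    qed
    then have "\<exists>L. \<forall>b\<in>B. (\<lambda>n. c n b) \<longlonglongrightarrow> L b"
      unfolding convergent_def by metis
    then obtain L where L: "\<And>b. b \<in> B \<Longrightarrow> (\<lambda>n. c n b) \<longlonglongrightarrow> L b" by blast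
    have "x \<longlonglongrightarrow> (\<Sum>b\<in>B. L b *\<^sub>R b)"
      unfolding c[abs_def] by (intro tendsto_intros L)
    then have "l = (\<Sum>b\<in>B. L b *\<^sub>R b)"
      using lim LIMSEQ_unique by blast
    then show ?thesis
      by (simp add: span_base span_scale span_sum)
  qed
  then show ?thesis
    unfolding closed_sequential_limits by blast
qed

text \<open>Induction over the basis. The span of the vectors already treated is closed, so the new
  vector \<open>a\<close> has a positive distance \<open>d\<close> from it. This distance controls
  the coefficient of \<open>a\<close>, and removing the multiple of \<open>a\<close> leaves a vector
  covered by the induction hypothesis.\<close>

lemma bounded_coordinates:
  fixes B :: "'e::real_normed_vector set"
  assumes "finite B" and "independent B"
  shows "\<exists>K. \<forall>c. \<forall>b\<in>B. \<bar>c b\<bar> \<le> K * norm (\<Sum>b\<in>B. c b *\<^sub>R b)"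
  using assms
proof (induction B rule: finite_induct)
  case empty
  then show ?case by simp
next
  case (insert a B)
  then obtain K where K: "\<And>c b. b \<in> B \<Longrightarrow> \<bar>c b\<bar> \<le> K * norm (\<Sum>b\<in>B. c b *\<^sub>R b)"
    using independent_mono[of "insert a B" B] by (metis subset_insertI)
  have "a \<notin> span B"
    using insert.prems insert.hyps independent_insert[of a B] by auto
  moreover have "closed (span B)"
    using closed_span_if_bounded_coordinates[OF insert.hyps(1) K] .
  ultimately have "open (- span B)" "a \<in> - span B"
    by (simp_all add: open_Compl)
  then obtain d where "d > 0" and ball: "ball a d \<subseteq> - span B"
    by (rule openE)
  have d: "d \<le> dist a y" if "y \<in> span B" for y
    using \<open>d > 0\<close> ball that by (auto simp: subset_eq not_less[symmetric])
  \<comment> \<open>1/d bounds the coefficient of \<open>a\<close>. The other bound is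
    \<open>K\<close>, enlarged by the cost of passing from \<open>T\<close> to
    \<open>s = T - c a *\<^sub>R a\<close>.\<close>
  define L where "L = max (1/d) (\<bar>K\<bar> * (1 + norm a / d))"
  have "\<bar>c b\<bar> \<le> L * norm (\<Sum>b\<in>insert a B. c b *\<^sub>R b)" if b: "b \<in> insert a B" for c b
  proof -
    define s where "s = (\<Sum>b\<in>B. c b *\<^sub>R b)"
    define T where "T = (\<Sum>b\<in>insert a B. c b *\<^sub>R b)"
    have T: "T = c a *\<^sub>R a + s"
      using insert.hyps by (simp add: T_def s_def)
    have s: "s \<in> span B"
      unfolding s_def by (simp add: span_base span_scale span_sum)
    have ca: "\<bar>c a\<bar> \<le> (1/d) * norm T"
    proof (cases "c a = 0")
      case True
      then show ?thesis using \<open>d > 0\<close> by simp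
    next
      case False
      \<comment> \<open>Dividing \<open>T\<close> by \<open>c a\<close> turns its norm into the
        distance from \<open>a\<close> to a vector of \<open>span B\<close>.\<close>
      have "d \<le> dist a ((- 1 / c a) *\<^sub>R s)"
        using s by (intro d span_scale)
      also have "\<dots> = norm ((1 / c a) *\<^sub>R T)"
        using False by (simp add: dist_norm T scaleR_right_distrib)
      also have "\<dots> = norm T / \<bar>c a\<bar>" by simp
      finally show ?thesis
        using \<open>d > 0\<close> False by (simp add: field_simps)
    qed
    show ?thesis
    proof (cases "b = a")
      case True
      have "(1/d) * norm T \<le> L * norm T"
        unfolding L_def by (rule mult_right_mono) auto
      then show ?thesis using ca True by (simp add: T_def)
    next
      case False
      then have "\<bar>c b\<bar> \<le> K * norm s"
        using K b unfolding s_def by auto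
      also have "\<dots> \<le> \<bar>K\<bar> * norm s"
        by (rule mult_right_mono) auto
      also have "norm s \<le> norm T + \<bar>c a\<bar> * norm a"
        using norm_triangle_ineq4[of T "c a *\<^sub>R a"] by (simp add: T)
      also have "\<dots> \<le> norm T + (1/d) * norm T * norm a"
        using ca by (intro add_left_mono mult_right_mono) auto
      also have "\<dots> = (1 + norm a / d) * norm T"
        by (simp add: algebra_simps)
      finally have "\<bar>c b\<bar> \<le> (\<bar>K\<bar> * (1 + norm a / d)) * norm T"
        by (simp add: mult_left_mono mult.assoc)
      also have "\<dots> \<le> L * norm T"
        unfolding L_def by (rule mult_right_mono) auto
      finally show ?thesis by (simp add: T_def)
    qed
  qed
  then show ?case by blast
qed

text \<open>Boundedness lets the coordinate functionals be composed with
  \<open>has_derivative\<close> and \<open>continuous_on\<close>.\<close>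

lemma bounded_linear_representation:
  fixes B :: "'e::real_normed_vector set"
  assumes "finite B" "independent B" "span B = UNIV"
  shows "bounded_linear (\<lambda>x. representation B x b)"
proof (cases "b \<in> B")
  case True
  obtain K where K: "\<And>c b. b \<in> B \<Longrightarrow> \<bar>c b\<bar> \<le> K * norm (\<Sum>b\<in>B. c b *\<^sub>R b)"
    using bounded_coordinates[OF assms(1,2)] by blast
  show ?thesis
  proof (rule bounded_linear_intro)
    show "representation B (x + y) b = representation B x b + representation B y b" for x y
      using assms by (simp add: representation_add)
    show "representation B (r *\<^sub>R x) b = r *\<^sub>R representation B x b" for r x
      using assms by (simp add: representation_scale)
    show "norm (representation B x b) \<le> norm x * K" for x
      using K[OF True, of "representation B x"] assms
      by (simp add: sum_representation_eq mult.commute)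
  qed
next
  case False
  then have "representation B x b = 0" for x
    using representation_ne_zero by blast
  then show ?thesis by (simp add: bounded_linear_zero)
qed

lemma finite_basis_exists:
  assumes "\<exists>B::'e::real_normed_vector set. finite B \<and> span B = UNIV"
  obtains B :: "'e::real_normed_vector set" where "finite B" "independent B" "span B = UNIV"
proof -
  obtain A :: "'e set" where "finite A" "span A = UNIV" using assms by blast
  obtain B where "B \<subseteq> A" "independent B" "A \<subseteq> span B"
    using maximal_independent_subset by blast
  then show ?thesis
    using that[of B] \<open>finite A\<close> \<open>span A = UNIV\<close> finite_subset span_mono[of A "span B"]
    by (metis span_span top.extremum_uniqueI)
qed

section \<open>Directional derivatives and smooth maps\<close>

abbreviation D :: "('a::real_normed_vector \<Rightarrow> 'b::real_normed_vector) \<Rightarrow> 'a \<Rightarrow> 'a \<Rightarrow> 'b" where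
  "D f x h \<equiv> frechet_derivative f (at x) h"

lemma D_eq: "(f has_derivative f') (at x) \<Longrightarrow> D f x h = f' h"
  by (metis frechet_derivative_at)

lemma has_derivative_D: "f differentiable (at x) \<Longrightarrow> (f has_derivative (\<lambda>h. D f x h)) (at x)"
  using frechet_derivative_works by blast

lemma linear_D: "f differentiable (at x) \<Longrightarrow> linear (\<lambda>h. D f x h)"
  using has_derivative_D has_derivative_linear by blast

lemma D_add:
  "f differentiable (at x) \<Longrightarrow> g differentiable (at x) \<Longrightarrow> D (\<lambda>y. f y + g y) x h = D f x h + D g x h"
  by (rule D_eq) (auto intro!: derivative_eq_intros has_derivative_D)

lemma D_mult:
  fixes f g :: "'a::real_normed_vector \<Rightarrow> real"
  shows "f differentiable (at x) \<Longrightarrow> g differentiable (at x) \<Longrightarrow>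
    D (\<lambda>y. f y * g y) x h = f x * D g x h + D f x h * g x"
  by (rule D_eq) (auto intro!: derivative_eq_intros has_derivative_D)

lemma D_cmult:
  fixes f :: "'a::real_normed_vector \<Rightarrow> real"
  shows "f differentiable (at x) \<Longrightarrow> D (\<lambda>y. a * f y) x h = a * D f x h"
  by (rule D_eq) (auto intro!: derivative_eq_intros has_derivative_D)

lemma D_sum:
  "(\<And>i. i \<in> I \<Longrightarrow> f i differentiable (at x)) \<Longrightarrow>
    D (\<lambda>y. \<Sum>i\<in>I. f i y) x h = (\<Sum>i\<in>I. D (f i) x h)"
  by (rule D_eq) (auto intro!: derivative_eq_intros has_derivative_D)

lemma D_const [simp]: "D (\<lambda>y. a) x h = 0"
  by (simp add: frechet_derivative_const)

lemma differentiable_sum_fun: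
  "(\<And>i. i \<in> I \<Longrightarrow> f i differentiable F) \<Longrightarrow> (\<lambda>y. \<Sum>i\<in>I. f i y) differentiable F"
  by (cases "finite I") auto

section \<open>Locality of derivatives and closure properties of smooth functions\<close>

lemma differentiable_cong_open:
  assumes "open S" "x \<in> S" "\<And>y. y \<in> S \<Longrightarrow> f y = g y"
  shows "f differentiable (at x) \<longleftrightarrow> g differentiable (at x)"
  unfolding differentiable_def
  using has_derivative_transform_within_open[OF _ assms(1,2)] assms(3) by metis

text \<open>\<open>frechet_derivative\<close> chooses some derivative. Both functions have the same
  derivatives at \<open>x\<close>, possibly none, so the same choice is made for both.\<close>

lemma D_cong_open:
  assumes "open S" "x \<in> S" "\<And>y. y \<in> S \<Longrightarrow> f y = g y"
  shows "D f x h = D g x h"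
proof -
  have "(f has_derivative f') (at x) \<longleftrightarrow> (g has_derivative f') (at x)" for f'
    using has_derivative_transform_within_open[OF _ assms(1,2)] assms(3) by metis
  then show ?thesis
    by (simp add: frechet_derivative_def)
qed

lemma Ck_on_cong:
  assumes "open S" "\<And>y. y \<in> S \<Longrightarrow> f y = g y" "Ck_on n S f"
  shows "Ck_on n S g"
  using assms(2,3)
proof (induction n arbitrary: f g)
  case 0
  then show ?case by (simp cong: continuous_on_cong)
next
  case (Suc n)
  show ?case
    unfolding Ck_on.simps
  proof (intro conjI ballI allI)
    fix x assume "x \<in> S"
    then show "g differentiable (at x)"
      using Suc.prems differentiable_cong_open[OF assms(1)] by (metis Ck_on.simps(2))
  next
    fix h
    show "Ck_on n S (\<lambda>x. D g x h)"
      by (rule Suc.IH[OF D_cong_open[OF assms(1) _ Suc.prems(1)]]) (use Suc.prems(2) in auto)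
  qed
qed

text \<open>The recursive definition does not list the lower orders. They are needed for products,
  since the derivative of \<open>f * g\<close> contains \<open>f\<close> and \<open>g\<close>
  themselves as factors.\<close>

lemma Ck_on_lower:
  assumes "Ck_on (Suc n) S f"
  shows "Ck_on n S f"
  using assms
proof (induction n arbitrary: f)
  case 0
  then show ?case
    by (auto intro!: continuous_at_imp_continuous_on differentiable_imp_continuous_within)
next
  case (Suc n)
  note prems = Suc.prems[unfolded Ck_on.simps(2)[of "Suc n" S f]]
  show ?case
    unfolding Ck_on.simps(2)[of n S f]
    by (intro conjI allI conjunct1[OF prems] Suc.IH) (rule conjunct2[OF prems, rule_format])
qed

lemma Ck_on_const: "Ck_on n S (\<lambda>x. a)"
  by (induction n arbitrary: a) auto

lemma Ck_on_add:
  assumes "open S" "Ck_on n S f" "Ck_on n S g"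
  shows "Ck_on n S (\<lambda>x. f x + g x)"
  using assms(2,3)
proof (induction n arbitrary: f g)
  case 0
  then show ?case by (auto intro: continuous_on_add)
next
  case (Suc n)
  have "Ck_on n S (\<lambda>x. D (\<lambda>x. f x + g x) x h)" for h
    by (rule Ck_on_cong[OF assms(1) _ Suc.IH[of "\<lambda>x. D f x h" "\<lambda>x. D g x h"]])
      (use Suc.prems in \<open>auto simp: D_add\<close>)
  then show ?case using Suc.prems by auto
qed

lemma Ck_on_mult:
  fixes f g :: "'a::real_normed_vector \<Rightarrow> real"
  assumes "open S" "Ck_on n S f" "Ck_on n S g"
  shows "Ck_on n S (\<lambda>x. f x * g x)"
  using assms(2,3)
proof (induction n arbitrary: f g)
  case 0
  then show ?case by (auto intro: continuous_on_mult)
next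
  case (Suc n)
  note low = Suc.prems[THEN Ck_on_lower]
  have "Ck_on n S (\<lambda>x. D (\<lambda>x. f x * g x) x h)" for h
    by (rule Ck_on_cong[OF assms(1) _ Ck_on_add[OF assms(1) Suc.IH[of f "\<lambda>x. D g x h"] Suc.IH[of "\<lambda>x. D f x h" g]]])
      (use Suc.prems low in \<open>auto simp: D_mult\<close>)
  then show ?case using Suc.prems by (auto intro: differentiable_mult)
qed

lemma smooth_on_cong:
  "open S \<Longrightarrow> (\<And>y. y \<in> S \<Longrightarrow> f y = g y) \<Longrightarrow> smooth_on S f \<Longrightarrow> smooth_on S g"
  unfolding smooth_on_def using Ck_on_cong by blast

lemma smooth_on_const: "smooth_on S (\<lambda>x. a)"
  by (simp add: smooth_on_def Ck_on_const)

lemma smooth_on_add: "open S \<Longrightarrow> smooth_on S f \<Longrightarrow> smooth_on S g \<Longrightarrow> smooth_on S (\<lambda>x. f x + g x)"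
  unfolding smooth_on_def using Ck_on_add by blast

lemma smooth_on_mult:
  fixes f g :: "'a::real_normed_vector \<Rightarrow> real"
  shows "open S \<Longrightarrow> smooth_on S f \<Longrightarrow> smooth_on S g \<Longrightarrow> smooth_on S (\<lambda>x. f x * g x)"
  unfolding smooth_on_def using Ck_on_mult by blast

lemma smooth_on_sum:
  assumes "open S" "\<And>i. i \<in> I \<Longrightarrow> smooth_on S (f i)"
  shows "smooth_on S (\<lambda>x. \<Sum>i\<in>I. f i x)"
  using assms(2)
  by (induction I rule: infinite_finite_induct) (auto intro: smooth_on_const smooth_on_add[OF assms(1)])

lemma smooth_on_D: "smooth_on S f \<Longrightarrow> smooth_on S (\<lambda>x. D f x h)"
  unfolding smooth_on_def using Ck_on.simps(2) by blast

lemma smooth_on_differentiable: "smooth_on S f \<Longrightarrow> x \<in> S \<Longrightarrow> f differentiable (at x)"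
  unfolding smooth_on_def using Ck_on.simps(2) by blast

lemma smooth_on_continuous: "smooth_on S f \<Longrightarrow> continuous_on S f"
  unfolding smooth_on_def using Ck_on.simps(1) by blast

section \<open>Symmetry of second derivatives\<close>

text \<open>The mean value theorem, applied once along \<open>h\<close> and once along
  \<open>k\<close>, turns the quotient into the mixed derivative at a point near \<open>x\<close>;
  continuity of that derivative does the rest.\<close>

lemma second_difference_quotient:
  fixes f :: "'a::real_normed_vector \<Rightarrow> real"
  assumes "open S" "x \<in> S" "smooth_on S f" "e > 0"
  shows "\<exists>d>0. \<forall>t. 0 < t \<and> t < d \<longrightarrow>
    \<bar>(f (x + t *\<^sub>R h + t *\<^sub>R k) - f (x + t *\<^sub>R h) - f (x + t *\<^sub>R k) + f x) / t\<^sup>2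
      - D (\<lambda>y. D f y h) x k\<bar> < e"
proof -
  define g where "g = (\<lambda>y. D (\<lambda>y. D f y h) y k)"
  have "continuous_on S g"
    unfolding g_def by (intro smooth_on_continuous smooth_on_D assms(3))
  then have "isCont g x"
    using assms(1,2) continuous_on_eq_continuous_at by blast
  then obtain r where r: "r > 0" "\<And>y. dist y x < r \<Longrightarrow> dist (g y) (g x) < e"
    using assms(4) unfolding continuous_at_eps_delta by (metis dist_commute)
  obtain s where s: "s > 0" "ball x s \<subseteq> S"
    using assms(1,2) openE by blast
  \<comment> \<open>For steps below \<open>R\<close> all points stay in \<open>S\<close> and in the
    region where \<open>g\<close> varies by less than \<open>e\<close>. The summand 1 keeps the
    divisor positive when \<open>h\<close> and \<open>k\<close> are 0.\<close>
  define R where "R = min r s / (norm h + norm k + 1)"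
  have N: "norm h + norm k + 1 > 0" by (simp add: add_nonneg_pos)
  have Rpos: "R > 0" using r s N by (simp add: R_def)
  have near: "dist (x + a *\<^sub>R h + b *\<^sub>R k) x < min r s" if "0 \<le> a" "0 \<le> b" "a < R" "b < R" for a b
  proof -
    have "dist (x + a *\<^sub>R h + b *\<^sub>R k) x = norm (a *\<^sub>R h + b *\<^sub>R k)"
      by (simp add: dist_norm add.assoc)
    also have "\<dots> \<le> a * norm h + b * norm k"
      using norm_triangle_ineq[of "a *\<^sub>R h" "b *\<^sub>R k"] that by simp
    also have "\<dots> \<le> R * norm h + R * norm k"
      using that by (intro add_mono mult_right_mono) auto
    also have "\<dots> < R * (norm h + norm k + 1)"
      using Rpos by (simp add: algebra_simps)
    also have "\<dots> = min r s" using N by (simp add: R_def)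
    finally show ?thesis .
  qed
  have inS: "x + a *\<^sub>R h + b *\<^sub>R k \<in> S" if "0 \<le> a" "0 \<le> b" "a < R" "b < R" for a b
    using near[OF that] s(2) by (auto simp: mem_ball dist_commute)
  have der1: "((\<lambda>a. f (x + a *\<^sub>R h + b *\<^sub>R k)) has_real_derivative D f (x + a *\<^sub>R h + b *\<^sub>R k) h) (at a)"
    if "0 \<le> a" "0 \<le> b" "a < R" "b < R" for a b
  proof -
    let ?y = "x + a *\<^sub>R h + b *\<^sub>R k"
    have fd: "f differentiable (at ?y)"
      using smooth_on_differentiable[OF assms(3) inS[OF that]] .
    have "((\<lambda>a. x + a *\<^sub>R h + b *\<^sub>R k) has_derivative (\<lambda>u. u *\<^sub>R h)) (at a)"
      by (auto intro!: derivative_eq_intros)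
    from has_derivative_compose[OF this has_derivative_D[OF fd]]
    show ?thesis
      using linear_scale[OF linear_D[OF fd]] by (simp add: has_field_derivative_def mult.commute[of _ "D f ?y h"])
  qed
  have der2: "((\<lambda>b. D f (x + a *\<^sub>R h + b *\<^sub>R k) h) has_real_derivative g (x + a *\<^sub>R h + b *\<^sub>R k)) (at b)"
    if "0 \<le> a" "0 \<le> b" "a < R" "b < R" for a b
  proof -
    let ?y = "x + a *\<^sub>R h + b *\<^sub>R k"
    have fd: "(\<lambda>y. D f y h) differentiable (at ?y)"
      using smooth_on_differentiable[OF smooth_on_D[OF assms(3)] inS[OF that]] .
    have "((\<lambda>b. x + a *\<^sub>R h + b *\<^sub>R k) has_derivative (\<lambda>u. u *\<^sub>R k)) (at b)"
      by (auto intro!: derivative_eq_intros)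
    from has_derivative_compose[OF this has_derivative_D[OF fd]]
    show ?thesis
      using linear_scale[OF linear_D[OF fd]]
      by (simp add: has_field_derivative_def g_def mult.commute[of _ "D (\<lambda>y. D f y h) ?y k"])
  qed
  show ?thesis
  proof (intro exI[of _ R] conjI Rpos allI impI)
    fix t assume t: "0 < t \<and> t < R"
    \<comment> \<open>The increment along \<open>k\<close>, as a function of the step along
      \<open>h\<close>. The term \<open>0 *\<^sub>R k\<close> is written out so that both summands
      are instances of \<open>der1\<close>.\<close>
    define \<phi> where "\<phi> = (\<lambda>a. f (x + a *\<^sub>R h + t *\<^sub>R k) - f (x + a *\<^sub>R h + 0 *\<^sub>R k))"
    have "\<exists>a>0. a < t \<and> \<phi> t - \<phi> 0 = (t - 0) * (D f (x + a *\<^sub>R h + t *\<^sub>R k) h - D f (x + a *\<^sub>R h + 0 *\<^sub>R k) h)"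
      unfolding \<phi>_def using t by (intro MVT2 DERIV_diff der1) auto
    then obtain a where a: "a > 0" "a < t"
      "\<phi> t - \<phi> 0 = t * (D f (x + a *\<^sub>R h + t *\<^sub>R k) h - D f (x + a *\<^sub>R h + 0 *\<^sub>R k) h)"
      by auto
    have "\<exists>b>0. b < t \<and> D f (x + a *\<^sub>R h + t *\<^sub>R k) h - D f (x + a *\<^sub>R h + 0 *\<^sub>R k) h
        = (t - 0) * g (x + a *\<^sub>R h + b *\<^sub>R k)"
      using t a by (intro MVT2 der2) auto
    then obtain b where b: "b > 0" "b < t"
      "D f (x + a *\<^sub>R h + t *\<^sub>R k) h - D f (x + a *\<^sub>R h + 0 *\<^sub>R k) h = t * g (x + a *\<^sub>R h + b *\<^sub>R k)"
      by auto
    have "\<phi> t - \<phi> 0 = t\<^sup>2 * g (x + a *\<^sub>R h + b *\<^sub>R k)"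
      using a b by (simp add: power2_eq_square)
    moreover have "\<phi> t - \<phi> 0 = f (x + t *\<^sub>R h + t *\<^sub>R k) - f (x + t *\<^sub>R h) - f (x + t *\<^sub>R k) + f x"
      by (simp add: \<phi>_def)
    ultimately have "(f (x + t *\<^sub>R h + t *\<^sub>R k) - f (x + t *\<^sub>R h) - f (x + t *\<^sub>R k) + f x) / t\<^sup>2
        = g (x + a *\<^sub>R h + b *\<^sub>R k)"
      using t by simp
    moreover have "dist (g (x + a *\<^sub>R h + b *\<^sub>R k)) (g x) < e"
      using near[of a b] a b t by (intro r(2)) auto
    ultimately show "\<bar>(f (x + t *\<^sub>R h + t *\<^sub>R k) - f (x + t *\<^sub>R h) - f (x + t *\<^sub>R k) + f x) / t\<^sup>2
      - D (\<lambda>y. D f y h) x k\<bar> < e"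
      by (simp add: dist_real_def g_def)
  qed
qed

text \<open>The second difference is symmetric in \<open>h\<close> and \<open>k\<close>, so its
  quotients approach both mixed derivatives. A tolerance of half the gap between the two is then
  contradictory.\<close>

lemma second_derivative_commute:
  fixes f :: "'a::real_normed_vector \<Rightarrow> real"
  assumes "open S" "x \<in> S" "smooth_on S f"
  shows "D (\<lambda>y. D f y h) x k = D (\<lambda>y. D f y k) x h"
proof (rule ccontr)
  let ?A = "D (\<lambda>y. D f y h) x k" and ?B = "D (\<lambda>y. D f y k) x h"
  assume "?A \<noteq> ?B"
  then have e: "\<bar>?A - ?B\<bar> / 2 > 0" by simp
  obtain d1 where d1: "d1 > 0" "\<And>t. 0 < t \<Longrightarrow> t < d1 \<Longrightarrow>
    \<bar>(f (x + t *\<^sub>R h + t *\<^sub>R k) - f (x + t *\<^sub>R h) - f (x + t *\<^sub>R k) + f x) / t\<^sup>2 - ?A\<bar> < \<bar>?A - ?B\<bar> / 2"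
    using second_difference_quotient[OF assms e] by blast
  obtain d2 where d2: "d2 > 0" "\<And>t. 0 < t \<Longrightarrow> t < d2 \<Longrightarrow>
    \<bar>(f (x + t *\<^sub>R k + t *\<^sub>R h) - f (x + t *\<^sub>R k) - f (x + t *\<^sub>R h) + f x) / t\<^sup>2 - ?B\<bar> < \<bar>?A - ?B\<bar> / 2"
    using second_difference_quotient[OF assms e] by blast
  define t where "t = min d1 d2 / 2"
  have t: "0 < t" "t < d1" "t < d2" using d1(1) d2(1) by (auto simp: t_def)
  have eq: "f (x + t *\<^sub>R k + t *\<^sub>R h) - f (x + t *\<^sub>R k) - f (x + t *\<^sub>R h) + f x
    = f (x + t *\<^sub>R h + t *\<^sub>R k) - f (x + t *\<^sub>R h) - f (x + t *\<^sub>R k) + f x"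
    by (simp add: add.assoc add.commute[of "t *\<^sub>R k" "t *\<^sub>R h"])
  have "\<bar>q - a\<bar> < \<bar>a - b\<bar> / 2 \<Longrightarrow> \<bar>q - b\<bar> < \<bar>a - b\<bar> / 2 \<Longrightarrow> False" for a b q :: real
    using abs_triangle_ineq4[of "q - b" "q - a"] by simp
  then show False
    using d1(2)[OF t(1,2)] d2(2)[OF t(1,3)] unfolding eq by blast
qed

text \<open>The mean value argument works for real values only. Coordinates reduce the vector case
  to it, because bounded linear functionals commute with \<open>D\<close>.\<close>

lemma second_derivative_commute_vector:
  fixes f :: "'a::real_normed_vector \<Rightarrow> 'e::real_normed_vector"
  assumes fin: "\<exists>B::'e set. finite B \<and> span B = UNIV"
    and "open S" "x \<in> S" "smooth_on S f"
  shows "D (\<lambda>y. D f y h) x k = D (\<lambda>y. D f y k) x h"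
proof -
  obtain B :: "'e set" where B: "finite B" "independent B" "span B = UNIV"
    using finite_basis_exists[OF fin] .
  let ?r = "\<lambda>b v. representation B v b"
  have D_r: "D (\<lambda>y. ?r b (g y)) y u = ?r b (D g y u)"
    if "g differentiable (at y)" for b y u and g :: "'a \<Rightarrow> 'e"
    by (rule D_eq) (rule bounded_linear.has_derivative[OF bounded_linear_representation[OF B] has_derivative_D[OF that]])
  have Ck_r: "Ck_on n S (\<lambda>y. ?r b (g y))" if "Ck_on n S g" for n b and g :: "'a \<Rightarrow> 'e"
    using that
  proof (induction n arbitrary: g)
    case 0
    then show ?case
      by (simp add: bounded_linear.continuous_on[OF bounded_linear_representation[OF B]])
  next
    case (Suc n)
    have "Ck_on n S (\<lambda>y. D (\<lambda>y. ?r b (g y)) y u)" for u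
      by (rule Ck_on_cong[OF assms(2) _ Suc.IH[of "\<lambda>y. D g y u"]]) (use Suc.prems D_r in auto)
    moreover have "(\<lambda>y. ?r b (g y)) differentiable (at y)" if "y \<in> S" for y
      using Suc.prems that bounded_linear.has_derivative[OF bounded_linear_representation[OF B] has_derivative_D]
      unfolding Ck_on.simps(2) differentiable_def by blast
    ultimately show ?case by simp
  qed
  have sm: "smooth_on S (\<lambda>y. ?r b (f y))" for b
    using assms(4) Ck_r unfolding smooth_on_def by blast
  have "?r b (D (\<lambda>y. D f y u) x w) = D (\<lambda>y. D (\<lambda>y. ?r b (f y)) y u) x w" for b u w
  proof -
    have "?r b (D (\<lambda>y. D f y u) x w) = D (\<lambda>y. ?r b (D f y u)) x w"
      using D_r smooth_on_differentiable[OF smooth_on_D[OF assms(4)] assms(3)] by metis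
    also have "\<dots> = D (\<lambda>y. D (\<lambda>y. ?r b (f y)) y u) x w"
      by (rule D_cong_open[OF assms(2,3)]) (use D_r smooth_on_differentiable[OF assms(4)] in simp)
    finally show ?thesis .
  qed
  then have "?r b (D (\<lambda>y. D f y h) x k) = ?r b (D (\<lambda>y. D f y k) x h)" for b
    using second_derivative_commute[OF assms(2,3) sm] by simp
  then have eq: "representation B (D (\<lambda>y. D f y h) x k) = representation B (D (\<lambda>y. D f y k) x h)"
    by (intro ext)
  have "(\<Sum>b\<in>B. ?r b w *\<^sub>R b) = w" for w
    using sum_representation_eq[OF B(2) _ B(1) order_refl] B(3) by simp
  from this[of "D (\<lambda>y. D f y h) x k"] this[of "D (\<lambda>y. D f y k) x h"] show ?thesis
    unfolding eq by (rule trans[OF sym])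
qed

section \<open>Antisymmetrization\<close>

text \<open>Left without the factor 1/n!, so that identities under reindexing carry signs only.
  \<open>F\<close> may depend on its arguments in any way.\<close>

definition alt :: "nat \<Rightarrow> ((nat \<Rightarrow> 'e) \<Rightarrow> real) \<Rightarrow> (nat \<Rightarrow> 'e) \<Rightarrow> real" where
  "alt n F v = (\<Sum>\<sigma> | \<sigma> permutes {..<n}. of_int (sign \<sigma>) * F (\<lambda>i. v (\<sigma> i)))"

lemma permutation_lessThan: "\<sigma> permutes {..<n::nat} \<Longrightarrow> permutation \<sigma>"
  using permutation_permutes by blast

lemma sign_mult_sign_mult [simp]: "real_of_int (sign p) * (of_int (sign p) * x) = x"
  by (cases p rule: sign_cases) auto

lemma alt_sum: "alt n (\<lambda>w. \<Sum>i\<in>I. F i w) v = (\<Sum>i\<in>I. alt n (F i) v)"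
  unfolding alt_def by (simp add: sum_distrib_left sum.swap[of _ I])

lemma alt_add: "alt n (\<lambda>w. F w + G w) v = alt n F v + alt n G v"
  unfolding alt_def by (simp add: distrib_left sum.distrib)

lemma alt_cmult: "alt n (\<lambda>w. a * F w) v = a * alt n F v"
  unfolding alt_def by (simp add: sum_distrib_left mult.left_commute)

lemma alt_permute:
  assumes "\<pi> permutes {..<n}"
  shows "alt n (\<lambda>w. F (\<lambda>i. w (\<pi> i))) v = of_int (sign \<pi>) * alt n F v"
proof -
  have "alt n F v = (\<Sum>\<sigma> | \<sigma> permutes {..<n}. of_int (sign (\<sigma> \<circ> \<pi>)) * F (\<lambda>i. v ((\<sigma> \<circ> \<pi>) i)))"
    unfolding alt_def using sum_permutations_compose_right[OF assms] .
  also have "\<dots> = (\<Sum>\<sigma> | \<sigma> permutes {..<n}. of_int (sign \<pi>) * (of_int (sign \<sigma>) * F (\<lambda>i. v (\<sigma> (\<pi> i)))))"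
    by (intro sum.cong refl)
      (simp add: sign_compose permutation_lessThan[OF assms] permutation_lessThan[where n = n] mult.left_commute)
  also have "\<dots> = of_int (sign \<pi>) * alt n (\<lambda>w. F (\<lambda>i. w (\<pi> i))) v"
    by (simp add: alt_def sum_distrib_left)
  finally show ?thesis by simp
qed

lemma alt_permute_args:
  assumes "\<pi> permutes {..<n}"
  shows "alt n F (\<lambda>i. v (\<pi> i)) = of_int (sign \<pi>) * alt n F v"
proof -
  have "alt n F v = (\<Sum>\<sigma> | \<sigma> permutes {..<n}. of_int (sign (\<pi> \<circ> \<sigma>)) * F (\<lambda>i. v ((\<pi> \<circ> \<sigma>) i)))"
    unfolding alt_def using setum_permutations_compose_left[OF assms] .
  also have "\<dots> = (\<Sum>\<sigma> | \<sigma> permutes {..<n}. of_int (sign \<pi>) * (of_int (sign \<sigma>) * F (\<lambda>i. v (\<pi> (\<sigma> i)))))"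
    by (intro sum.cong refl)
      (simp add: sign_compose permutation_lessThan[OF assms] permutation_lessThan[where n = n] mult.assoc)
  also have "\<dots> = of_int (sign \<pi>) * alt n F (\<lambda>i. v (\<pi> i))"
    by (simp add: alt_def sum_distrib_left)
  finally show ?thesis by simp
qed

lemma alt_eq_0_if_repeated:
  assumes "a < n" "b < n" "a \<noteq> b" "v a = v b"
  shows "alt n F v = 0"
proof -
  have "(\<lambda>i. v (Transposition.transpose a b i)) = v"
    using assms(4) by (auto simp: Transposition.transpose_def)
  then show ?thesis
    using alt_permute_args[OF permutes_swap_id, of a n b F v] assms by (simp add: sign_swap_id)
qed

text \<open>Transposing the two slots multiplies the antisymmetrization by -1 while leaving
  \<open>F\<close> as it is, so the value equals its own negative.\<close>

lemma alt_eq_0_if_symmetric: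
  assumes "a < n" "b < n" "a \<noteq> b" "\<And>w. F (\<lambda>i. w (Transposition.transpose a b i)) = F w"
  shows "alt n F v = 0"
  using alt_permute[OF permutes_swap_id, of a n b F v] assms by (simp add: sign_swap_id)

text \<open>The cycle \<open>0 \<mapsto> i, 1 \<mapsto> 0, \<dots>, i \<mapsto> i - 1\<close>.\<close>

primrec cycle_to :: "nat \<Rightarrow> nat \<Rightarrow> nat" where
  "cycle_to 0 = id"
| "cycle_to (Suc i) = Transposition.transpose i (Suc i) \<circ> cycle_to i"

lemma cycle_to_permutes: "i < n \<Longrightarrow> cycle_to i permutes {..<n}"
  by (induction i) (auto intro!: permutes_compose permutes_swap_id permutes_id simp del: o_apply)

lemma sign_cycle_to: "sign (cycle_to i) = (- 1) ^ i"
proof (induction i)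
  case (Suc i)
  have "permutation (cycle_to i)"
    using cycle_to_permutes[of i "Suc i"] permutation_lessThan by blast
  then show ?case
    using sign_compose[OF permutation_swap_id, of "cycle_to i" i "Suc i"] Suc
    by (simp add: comp_def sign_swap_id)
qed simp

lemma cycle_to_apply: "cycle_to i j = (case j of 0 \<Rightarrow> i | Suc k \<Rightarrow> if k < i then k else j)"
  by (induction i) (auto simp: Transposition.transpose_def split: nat.splits)

text \<open>Links permutations to \<open>ext_deriv\<close>: the cycle moves the argument
  \<open>v i\<close> to the front and leaves \<open>omit i v\<close> behind it.\<close>

lemma permute_cycle_to: "(\<lambda>j. v (cycle_to i j)) = case_nat (v i) (omit i v)"
  by (auto simp: cycle_to_apply omit_def fun_eq_iff split: nat.splits)

text \<open>The permutation that fixes 0 and acts as \<sigma> on the successors. Transporting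
  \<sigma> along \<open>Suc\<close> by \<open>map_permutation\<close> provides the sign at
  once.\<close>

definition shift_perm :: "nat \<Rightarrow> (nat \<Rightarrow> nat) \<Rightarrow> nat \<Rightarrow> nat" where
  "shift_perm n \<sigma> = map_permutation {..<n} Suc \<sigma>"

lemma shift_perm_apply:
  assumes "\<sigma> permutes {..<n}"
  shows "shift_perm n \<sigma> j = case_nat 0 (\<lambda>k. Suc (\<sigma> k)) j"
proof (cases j)
  case 0
  have "map_permutation {..<n} Suc \<sigma> permutes Suc ` {..<n}"
    by (rule map_permutation_permutes) (auto intro: bij_betw_imageI permutes_imp_bij assms)
  then show ?thesis
    using 0 by (simp add: shift_perm_def permutes_not_in)
next
  case (Suc k)
  have p: "map_permutation {..<n} Suc \<sigma> permutes Suc ` {..<n}"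
    by (rule map_permutation_permutes) (auto intro: bij_betw_imageI permutes_imp_bij assms)
  show ?thesis
  proof (cases "k < n")
    case True
    then show ?thesis
      using Suc map_permutation_apply[of Suc "{..<n}" k \<sigma>] by (simp add: shift_perm_def)
  next
    case False
    then have "Suc k \<notin> Suc ` {..<n}" by auto
    then show ?thesis
      using Suc False p assms by (simp add: shift_perm_def permutes_not_in)
  qed
qed

lemma sign_shift_perm: "\<sigma> permutes {..<n} \<Longrightarrow> sign (shift_perm n \<sigma>) = sign \<sigma>"
  unfolding shift_perm_def by (rule sign_map_permutation) auto

lemma shift_perm_permutes:
  assumes "\<sigma> permutes {..<n}"
  shows "shift_perm n \<sigma> permutes {..<Suc n}"
proof -
  have "map_permutation {..<n} Suc \<sigma> permutes Suc ` {..<n}"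
    by (rule map_permutation_permutes) (auto intro: bij_betw_imageI permutes_imp_bij assms)
  then show ?thesis
    unfolding shift_perm_def by (rule permutes_subset) auto
qed

text \<open>A permutation of \<open>{0, \<dots>, n}\<close> is determined by the image \<open>i\<close> of \<open>0\<close> and a permutation
  of the other \<open>n\<close> positions.\<close>

lemma bij_betw_permutations_Suc:
  "bij_betw (\<lambda>(i, \<sigma>). cycle_to i \<circ> shift_perm n \<sigma>) ({..n} \<times> {\<sigma>. \<sigma> permutes {..<n}})
     {\<rho>. \<rho> permutes {..<Suc n}}"
proof -
  let ?f = "\<lambda>(i, \<sigma>). cycle_to i \<circ> shift_perm n \<sigma>"
  let ?A = "{..n} \<times> {\<sigma>. \<sigma> permutes {..<n}}"
  let ?B = "{\<rho>. \<rho> permutes {..<Suc n}}"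
  have inj: "inj_on ?f ?A"
  proof (rule inj_onI, clarsimp)
    fix i \<sigma> i' \<sigma>'
    assume \<sigma>: "\<sigma> permutes {..<n}" and \<sigma>': "\<sigma>' permutes {..<n}"
      and eq: "cycle_to i \<circ> shift_perm n \<sigma> = cycle_to i' \<circ> shift_perm n \<sigma>'"
    have i: "i = i'"
      \<comment> \<open>Shifted permutations fix 0, so the value at 0 reveals the cycle.\<close>
      using fun_cong[OF eq, of 0] by (simp add: shift_perm_apply[OF \<sigma>] shift_perm_apply[OF \<sigma>'] cycle_to_apply)
    have "inj (cycle_to i)"
      using cycle_to_permutes[of i "Suc i"] permutes_inj by blast
    then have "shift_perm n \<sigma> = shift_perm n \<sigma>'"
      using eq i by (auto simp: fun_eq_iff inj_def)
    then have "shift_perm n \<sigma> (Suc k) = shift_perm n \<sigma>' (Suc k)" for k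
      by simp
    then have "\<sigma> k = \<sigma>' k" for k
      by (simp add: shift_perm_apply[OF \<sigma>] shift_perm_apply[OF \<sigma>'])
    then show "i = i' \<and> \<sigma> = \<sigma>'"
      using i by auto
  qed
  have sub: "?f ` ?A \<subseteq> ?B"
    by (auto intro!: permutes_compose cycle_to_permutes shift_perm_permutes simp del: o_apply)
  \<comment> \<open>Surjectivity by counting: (n + 1) * n! = (n + 1)!.\<close>
  have card: "card ?A = card ?B"
    by (simp add: card_cartesian_product card_permutations)
  have "finite ?B"
    by (simp add: finite_permutations)
  then show ?thesis
    unfolding bij_betw_def using inj card_subset_eq[OF _ sub] card_image[OF inj] card by simp
qed

text \<open>Laplace expansion along slot 0: the permutations are grouped by the image
  \<open>i\<close> of 0, and (-1)^i is the sign of the cycle in the factorization.\<close>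

lemma alt_Suc:
  "alt (Suc n) F v = (\<Sum>i\<le>n. (- 1) ^ i * alt n (\<lambda>w. F (case_nat (v i) w)) (omit i v))"
proof -
  have "alt (Suc n) F v = (\<Sum>(i, \<sigma>)\<in>{..n} \<times> {\<sigma>. \<sigma> permutes {..<n}}.
      of_int (sign (cycle_to i \<circ> shift_perm n \<sigma>)) * F (\<lambda>j. v ((cycle_to i \<circ> shift_perm n \<sigma>) j)))"
    unfolding alt_def sum.reindex_bij_betw[OF bij_betw_permutations_Suc, symmetric]
    by (simp add: split_def)
  also have "\<dots> = (\<Sum>(i, \<sigma>)\<in>{..n} \<times> {\<sigma>. \<sigma> permutes {..<n}}.
      (- 1) ^ i * (of_int (sign \<sigma>) * F (case_nat (v i) (\<lambda>j. omit i v (\<sigma> j)))))"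
  proof (rule sum.cong[OF refl])
    fix x
    assume "x \<in> {..n} \<times> {\<sigma>. \<sigma> permutes {..<n}}"
    then obtain i \<sigma> where x: "x = (i, \<sigma>)" and i: "i \<in> {..n}" and \<sigma>: "\<sigma> permutes {..<n}"
      by blast
    have "permutation (cycle_to i)" "permutation (shift_perm n \<sigma>)"
      using cycle_to_permutes[of i "Suc n"] shift_perm_permutes[OF \<sigma>] i
      by (auto intro: permutation_lessThan)
    then have "sign (cycle_to i \<circ> shift_perm n \<sigma>) = (- 1) ^ i * sign \<sigma>"
      by (simp add: sign_compose sign_cycle_to sign_shift_perm \<sigma>)
    moreover have "(\<lambda>j. v ((cycle_to i \<circ> shift_perm n \<sigma>) j)) = case_nat (v i) (\<lambda>j. omit i v (\<sigma> j))"
    proof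
      fix j
      show "v ((cycle_to i \<circ> shift_perm n \<sigma>) j) = case_nat (v i) (\<lambda>j. omit i v (\<sigma> j)) j"
        using fun_cong[OF permute_cycle_to[of v i], of "shift_perm n \<sigma> j"]
        by (cases j) (simp_all add: shift_perm_apply[OF \<sigma>])
    qed
    ultimately show "(case x of (i, \<sigma>) \<Rightarrow>
        of_int (sign (cycle_to i \<circ> shift_perm n \<sigma>)) * F (\<lambda>j. v ((cycle_to i \<circ> shift_perm n \<sigma>) j)))
      = (case x of (i, \<sigma>) \<Rightarrow>
        (- 1) ^ i * (of_int (sign \<sigma>) * F (case_nat (v i) (\<lambda>j. omit i v (\<sigma> j)))))"
      unfolding x prod.case by simp
  qed
  also have "\<dots> = (\<Sum>i\<le>n. (- 1) ^ i * alt n (\<lambda>w. F (case_nat (v i) w)) (omit i v))"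
    by (simp add: sum.cartesian_product[symmetric] alt_def sum_distrib_left)
  finally show ?thesis .
qed

section \<open>Alternating forms\<close>

lemma alternating_cong:
  "f \<in> alternating_forms k \<Longrightarrow> (\<And>i. i < k \<Longrightarrow> v i = w i) \<Longrightarrow> f v = f w"
  by (simp add: alternating_forms_def)

lemma alternating_linear:
  "f \<in> alternating_forms k \<Longrightarrow> i < k \<Longrightarrow> linear (\<lambda>u. f (v(i := u)))"
  unfolding alternating_forms_def by blast

lemma alternating_repeated:
  "f \<in> alternating_forms k \<Longrightarrow> i < k \<Longrightarrow> j < k \<Longrightarrow> i \<noteq> j \<Longrightarrow> v i = v j \<Longrightarrow> f v = 0"
  unfolding alternating_forms_def by blast

text \<open>Polarization: with \<open>v a + v b\<close> in both slots the value is 0, and by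
  additivity only the two mixed terms survive.\<close>

lemma alternating_transpose:
  assumes f: "f \<in> alternating_forms k" and "a < k" "b < k" "a \<noteq> b"
  shows "f (\<lambda>i. v (Transposition.transpose a b i)) = - f v"
proof -
  let ?F = "\<lambda>x y. f (v(a := x, b := y))"
  have add_b: "?F x (y + z) = ?F x y + ?F x z" for x y z
    using linear_add[OF alternating_linear[OF f assms(3), of "v(a := x)"]] .
  have add_a: "?F (x + y) z = ?F x z + ?F y z" for x y z
    using linear_add[OF alternating_linear[OF f assms(2), of "v(b := z)"]] assms(4)
    by (simp add: fun_upd_twist)
  have rep: "?F x x = 0" for x
    by (rule alternating_repeated[OF f assms(2-4)]) (use assms(4) in auto)
  have "0 = ?F (v a + v b) (v a + v b)"
    by (simp only: rep)
  also have "\<dots> = ?F (v b) (v a) + ?F (v a) (v b)"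
    by (simp only: add_a add_b) (simp only: rep add_0_left add_0_right)
  finally have "?F (v b) (v a) + ?F (v a) (v b) = 0" by simp
  moreover have "(\<lambda>i. v (Transposition.transpose a b i)) = v(a := v b, b := v a)"
    by (auto simp: Transposition.transpose_def)
  ultimately show ?thesis by simp
qed

lemma alternating_permute:
  assumes f: "f \<in> alternating_forms k" and \<sigma>: "\<sigma> permutes {..<k}"
  shows "f (\<lambda>i. v (\<sigma> i)) = of_int (sign \<sigma>) * f v"
proof -
  have "finite {..<k}" by simp
  from \<sigma> this show ?thesis
  proof (induction arbitrary: v rule: permutes_induct)
    case id
    then show ?case by simp
  next
    case (swap a b p)
    have "f (\<lambda>i. v ((Transposition.transpose a b \<circ> p) i)) = of_int (sign p) * f (\<lambda>i. v (Transposition.transpose a b i))"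
      using swap.IH[of "\<lambda>i. v (Transposition.transpose a b i)"] by simp
    also have "\<dots> = - (of_int (sign p) * f v)"
      using swap.hyps by (subst alternating_transpose[OF f]) auto
    also have "\<dots> = of_int (sign (Transposition.transpose a b \<circ> p)) * f v"
      using swap.hyps
      by (simp add: sign_compose permutation_swap_id sign_swap_id permutation_lessThan[where n = k])
    finally show ?case .
  qed
qed

lemma alt_alternating:
  assumes "f \<in> alternating_forms k"
  shows "alt k f v = fact k * f v"
proof -
  have "alt k f v = (\<Sum>\<sigma> | \<sigma> permutes {..<k}. f v)"
    unfolding alt_def
  proof (rule sum.cong[OF refl])
    fix \<sigma>
    assume "\<sigma> \<in> {\<sigma>. \<sigma> permutes {..<k}}"
    then show "of_int (sign \<sigma>) * f (\<lambda>i. v (\<sigma> i)) = f v"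
      using alternating_permute[OF assms, of \<sigma> v] by simp
  qed
  then show ?thesis by (simp add: card_permutations)
qed

text \<open>The bridge between the signed sums of \<open>ext_deriv\<close> and \<open>alt\<close>:
  in the Laplace expansion each inner antisymmetrization just multiplies by k!.\<close>

lemma alternating_sum_eq_alt:
  assumes "\<And>a. (\<lambda>w. F (case_nat a w)) \<in> alternating_forms k"
  shows "(\<Sum>i\<le>k. (- 1) ^ i * F (case_nat (v i) (omit i v))) = alt (Suc k) F v / fact k"
  by (simp add: alt_Suc alt_alternating[OF assms] sum_divide_distrib)

lemma zero_alternating: "(\<lambda>v. 0) \<in> alternating_forms k"
  unfolding alternating_forms_def by (simp add: linear_iff)

lemma add_alternating:
  "f \<in> alternating_forms k \<Longrightarrow> g \<in> alternating_forms k \<Longrightarrow> (\<lambda>v. f v + g v) \<in> alternating_forms k"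
  unfolding alternating_forms_def by (auto intro!: linear_compose_add) metis

lemma cmult_alternating:
  assumes "f \<in> alternating_forms k"
  shows "(\<lambda>v. a * f v) \<in> alternating_forms k"
proof -
  have "linear (\<lambda>u. a * f (v(i := u)))" if "i < k" for v i
    using linear_compose_scale_right[OF alternating_linear[OF assms that], of a] by simp
  then show ?thesis
    using assms unfolding alternating_forms_def by (auto; metis)
qed

text \<open>Replaces a moving argument by fixed basis vectors with real coefficients, so that the
  ordinary product rule applies to it.\<close>

lemma alternating_expand:
  assumes "f \<in> alternating_forms k" "m < k" "finite B" "independent B" "span B = UNIV"
  shows "f (u(m := z)) = (\<Sum>b\<in>B. representation B z b * f (u(m := b)))"
proof -
  note lin = alternating_linear[OF assms(1,2), of u]
  have "f (u(m := z)) = f (u(m := (\<Sum>b\<in>B. representation B z b *\<^sub>R b)))"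
    using sum_representation_eq[OF assms(4), of z B] assms by simp
  also have "\<dots> = (\<Sum>b\<in>B. representation B z b * f (u(m := b)))"
    by (simp add: linear_sum[OF lin] linear_scale[OF lin])
  finally show ?thesis .
qed

section \<open>Derivatives of families of alternating forms\<close>

lemma D_divide:
  fixes f :: "'a::real_normed_vector \<Rightarrow> real"
  shows "f differentiable (at x) \<Longrightarrow> D (\<lambda>y. f y / a) x h = D f x h / a"
  using D_cmult[of f x "1 / a" h] by simp

lemma D_alternating:
  fixes \<Phi> :: "'e::real_normed_vector \<Rightarrow> (nat \<Rightarrow> 'e) \<Rightarrow> real"
  assumes A: "\<And>y. \<Phi> y \<in> alternating_forms k" and d: "\<And>u. (\<lambda>y. \<Phi> y u) differentiable (at x)"
  shows "(\<lambda>u. D (\<lambda>y. \<Phi> y u) x h) \<in> alternating_forms k"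
proof -
  have "D (\<lambda>y. \<Phi> y v) x h = D (\<lambda>y. \<Phi> y w) x h" if "\<forall>i<k. v i = w i" for v w
    using alternating_cong[OF A, of v w] that by simp
  moreover have "linear (\<lambda>u. D (\<lambda>y. \<Phi> y (v(i := u))) x h)" if "i < k" for v i
  proof (rule linearI)
    note lin = alternating_linear[OF A that]
    show "D (\<lambda>y. \<Phi> y (v(i := a + b))) x h
      = D (\<lambda>y. \<Phi> y (v(i := a))) x h + D (\<lambda>y. \<Phi> y (v(i := b))) x h" for a b
      by (simp add: linear_add[OF lin] D_add d)
    show "D (\<lambda>y. \<Phi> y (v(i := r *\<^sub>R a))) x h = r *\<^sub>R D (\<lambda>y. \<Phi> y (v(i := a))) x h" for r a
      by (simp add: linear_scale[OF lin] D_cmult d)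
  qed
  moreover have "D (\<lambda>y. \<Phi> y v) x h = 0" if "i < k" "j < k" "i \<noteq> j" "v i = v j" for v i j
    using alternating_repeated[OF A that] by simp
  ultimately show ?thesis
    unfolding alternating_forms_def mem_Collect_eq by (intro conjI allI impI) assumption+
qed

text \<open>Differentiability of the form is given only for fixed arguments. The arguments are
  therefore set in motion one at a time, each being expanded in a basis before the product rule is
  used.\<close>

lemma has_derivative_multilinear:
  fixes \<Phi> :: "'e::real_normed_vector \<Rightarrow> (nat \<Rightarrow> 'e) \<Rightarrow> real" and w :: "nat \<Rightarrow> 'e \<Rightarrow> 'e"
  assumes fin: "\<exists>B::'e set. finite B \<and> span B = UNIV"
    and A: "\<And>y. \<Phi> y \<in> alternating_forms k" and d: "\<And>u. (\<lambda>y. \<Phi> y u) differentiable (at x)"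
    and w: "\<And>i. w i differentiable (at x)"
  shows "((\<lambda>y. \<Phi> y (\<lambda>i. w i y)) has_derivative
    (\<lambda>h. D (\<lambda>y. \<Phi> y (\<lambda>i. w i x)) x h + (\<Sum>j<k. \<Phi> x ((\<lambda>i. w i x)(j := D (w j) x h))))) (at x)"
proof -
  obtain B :: "'e set" where B: "finite B" "independent B" "span B = UNIV"
    using finite_basis_exists[OF fin] .
  let ?r = "\<lambda>v b. representation B v b"
  \<comment> \<open>The first \<open>m\<close> arguments move with the point, the others stay at
    \<open>u\<close>. The induction keeps \<open>u\<close> arbitrary because the expansion puts
    basis vectors into slot \<open>m\<close>.\<close>
  define W where "W = (\<lambda>m (u :: nat \<Rightarrow> 'e) y i. if i < m then w i y else u i)"
  have "((\<lambda>y. \<Phi> y (W m u y)) has_derivative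
    (\<lambda>h. D (\<lambda>y. \<Phi> y (W m u x)) x h + (\<Sum>j<m. \<Phi> x ((W m u x)(j := D (w j) x h))))) (at x)"
    if "m \<le> k" for m u
    using that
  proof (induction m arbitrary: u)
    case 0
    show ?case using has_derivative_D[OF d] by (simp add: W_def)
  next
    case (Suc m)
    then have m: "m < k" by simp
    note expand = alternating_expand[OF _ m B]
    have W_upd: "(W (Suc m) u y)(m := b) = W m (u(m := b)) y" for y b
      by (auto simp: W_def)
    have W_self: "W m (u(m := w m y)) y = W (Suc m) u y" for y
      by (auto simp: W_def fun_eq_iff less_Suc_eq)
    have "((\<lambda>y. \<Sum>b\<in>B. ?r (w m y) b * \<Phi> y (W m (u(m := b)) y)) has_derivative
      (\<lambda>h. \<Sum>b\<in>B. ?r (w m x) b *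
          (D (\<lambda>y. \<Phi> y (W m (u(m := b)) x)) x h + (\<Sum>j<m. \<Phi> x ((W m (u(m := b)) x)(j := D (w j) x h))))
        + ?r (D (w m) x h) b * \<Phi> x (W m (u(m := b)) x))) (at x)"
      using m
      by (intro has_derivative_sum has_derivative_mult Suc.IH
          bounded_linear.has_derivative[OF bounded_linear_representation[OF B]] has_derivative_D w) simp
    moreover have "(\<Sum>b\<in>B. ?r (w m y) b * \<Phi> y (W m (u(m := b)) y)) = \<Phi> y (W (Suc m) u y)" for y
      using expand[OF A, of y "W (Suc m) u y" "w m y"] by (simp add: W_upd W_self)
    \<comment> \<open>The sums over the basis are collapsed again: coordinates of
      \<open>w m x\<close> restore the moving argument, those of its derivative produce the new
      summand \<open>j = m\<close>.\<close>
    moreover have "(\<Sum>b\<in>B. ?r (w m x) b *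
          (D (\<lambda>y. \<Phi> y (W m (u(m := b)) x)) x h + (\<Sum>j<m. \<Phi> x ((W m (u(m := b)) x)(j := D (w j) x h))))
        + ?r (D (w m) x h) b * \<Phi> x (W m (u(m := b)) x))
      = D (\<lambda>y. \<Phi> y (W (Suc m) u x)) x h + (\<Sum>j<Suc m. \<Phi> x ((W (Suc m) u x)(j := D (w j) x h)))" for h
    proof -
      have "(\<Sum>b\<in>B. ?r (w m x) b * D (\<lambda>y. \<Phi> y (W m (u(m := b)) x)) x h)
        = D (\<lambda>y. \<Phi> y (W (Suc m) u x)) x h"
        using expand[OF D_alternating[OF A d], of "W (Suc m) u x" "w m x" h]
        by (simp add: W_upd W_self)
      moreover have "(\<Sum>b\<in>B. ?r (w m x) b * \<Phi> x ((W m (u(m := b)) x)(j := D (w j) x h)))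
        = \<Phi> x ((W (Suc m) u x)(j := D (w j) x h))" if "j < m" for j
      proof -
        have "((W (Suc m) u x)(j := D (w j) x h))(m := b) = (W m (u(m := b)) x)(j := D (w j) x h)" for b
          using that by (auto simp: W_def)
        moreover have "((W (Suc m) u x)(j := D (w j) x h))(m := w m x) = (W (Suc m) u x)(j := D (w j) x h)"
          using that by (auto simp: W_def)
        ultimately show ?thesis
          using expand[OF A, of x "(W (Suc m) u x)(j := D (w j) x h)" "w m x"] by simp
      qed
      moreover have "(\<Sum>b\<in>B. ?r (D (w m) x h) b * \<Phi> x (W m (u(m := b)) x))
        = \<Phi> x ((W (Suc m) u x)(m := D (w m) x h))"
        using expand[OF A, of x "W (Suc m) u x" "D (w m) x h"] by (simp add: W_upd)
      ultimately show ?thesis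
        by (simp add: sum.distrib distrib_left sum_distrib_left sum.swap[of _ _ B])
    qed
    ultimately show ?case by (simp only:)
  qed
  from this[of k "\<lambda>i. w i x"] have
    "((\<lambda>y. \<Phi> y (W k (\<lambda>i. w i x) y)) has_derivative
    (\<lambda>h. D (\<lambda>y. \<Phi> y (\<lambda>i. w i x)) x h + (\<Sum>j<k. \<Phi> x ((\<lambda>i. w i x)(j := D (w j) x h))))) (at x)"
    by (simp add: W_def)
  moreover have "\<Phi> y (W k (\<lambda>i. w i x) y) = \<Phi> y (\<lambda>i. w i y)" for y
    by (rule alternating_cong[OF A]) (simp add: W_def)
  ultimately show ?thesis by simp
qed

lemma D_alt:
  fixes P :: "'e::real_normed_vector \<Rightarrow> (nat \<Rightarrow> 'e) \<Rightarrow> real"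
  assumes "\<And>w. (\<lambda>y. P y w) differentiable (at x)"
  shows "D (\<lambda>y. alt n (P y) u) x h = alt n (\<lambda>w. D (\<lambda>y. P y w) x h) u"
  unfolding alt_def by (simp add: D_sum D_cmult assms)

lemma differentiable_alt:
  fixes P :: "'e::real_normed_vector \<Rightarrow> (nat \<Rightarrow> 'e) \<Rightarrow> real"
  assumes "\<And>w. (\<lambda>y. P y w) differentiable (at x)"
  shows "(\<lambda>y. alt n (P y) u) differentiable (at x)"
  unfolding alt_def by (intro differentiable_sum_fun differentiable_mult differentiable_const assms)

text \<open>The Laplace expansion read backwards: differentiating an antisymmetrized expression
  again gives an antisymmetrization, with the new direction in slot 0.\<close>

lemma sum_D_alt:
  fixes P :: "'e::real_normed_vector \<Rightarrow> (nat \<Rightarrow> 'e) \<Rightarrow> real"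
  assumes "\<And>w. (\<lambda>y. P y w) differentiable (at x)"
  shows "(\<Sum>i\<le>n. (- 1) ^ i * D (\<lambda>y. alt n (P y) (omit i v)) x (v i))
    = alt (Suc n) (\<lambda>w. D (\<lambda>y. P y (\<lambda>i. w (Suc i))) x (w 0)) v"
  by (simp add: alt_Suc D_alt[OF assms])

section \<open>The exterior derivative\<close>

locale smooth_atlas =
  fixes Y :: "'a topology" and \<A> :: "('a, 'e::real_normed_vector) chart set"
  assumes manifold: "smooth_manifold Y \<A>"
begin

lemma finite_dimensional: "\<exists>B::'e set. finite B \<and> span B = UNIV"
  and chart: "c \<in> \<A> \<Longrightarrow> is_chart Y c"
  and smooth_transition: "c \<in> \<A> \<Longrightarrow> c' \<in> \<A> \<Longrightarrow> smooth_on (overlap c c') (transition c c')"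
  using manifold unfolding smooth_manifold_def by blast+

lemma open_chart_image: "c \<in> \<A> \<Longrightarrow> open (chart_image c)"
  using chart unfolding is_chart_def by blast

lemma inj_on_chart:
  assumes "c \<in> \<A>"
  shows "inj_on (snd c) (fst c)"
proof -
  have "openin Y (fst c)"
    and "homeomorphic_map (subtopology Y (fst c)) (top_of_set (chart_image c)) (snd c)"
    using chart[OF assms] unfolding is_chart_def by auto
  then show ?thesis
    by (metis homeomorphic_imp_injective_map topspace_subtopology_subset openin_subset)
qed

lemma open_overlap:
  assumes "c \<in> \<A>" "c' \<in> \<A>"
  shows "open (overlap c c')"
proof -
  have c: "openin Y (fst c)" "openin Y (fst c')"
      "homeomorphic_map (subtopology Y (fst c)) (top_of_set (chart_image c)) (snd c)"
    using assms[THEN chart] unfolding is_chart_def by auto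
  have "openin (subtopology Y (fst c)) (fst c \<inter> fst c')"
    using c(2) by (metis Int_commute openin_subtopology_Int)
  then have "openin (top_of_set (chart_image c)) (snd c ` (fst c \<inter> fst c'))"
    using homeomorphic_imp_open_map[OF c(3)] unfolding open_map_def by blast
  then show ?thesis
    unfolding overlap_def using openin_open_trans[OF _ open_chart_image[OF assms(1)]] by blast
qed

lemma overlap_subset: "x \<in> overlap c c' \<Longrightarrow> x \<in> chart_image c"
  by (auto simp: overlap_def chart_image_def)

lemma transition_in_chart_image:
  assumes "c \<in> \<A>" "x \<in> overlap c c'"
  shows "transition c c' x \<in> chart_image c'"
  using assms(2) inv_into_f_f[OF inj_on_chart[OF assms(1)]]
  by (auto simp: overlap_def chart_image_def transition_def)

end

lemma form_eq_0: "\<omega> \<in> forms \<A> k \<Longrightarrow> c \<notin> \<A> \<or> x \<notin> chart_image c \<Longrightarrow> \<omega> c x = (\<lambda>v. 0)"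
  unfolding forms_def mem_Collect_eq by blast

text \<open>Thanks to the default value 0 this holds at every index and point, as the hypotheses of
  \<open>D_alternating\<close> and \<open>has_derivative_multilinear\<close> demand.\<close>

lemma form_alternating:
  assumes "\<omega> \<in> forms \<A> k"
  shows "\<omega> c x \<in> alternating_forms k"
proof (cases "c \<in> \<A> \<and> x \<in> chart_image c")
  case True
  then show ?thesis using assms unfolding forms_def mem_Collect_eq by blast
next
  case False
  then show ?thesis using form_eq_0[OF assms, of c x] zero_alternating by simp
qed

lemma form_smooth: "\<omega> \<in> forms \<A> k \<Longrightarrow> c \<in> \<A> \<Longrightarrow> smooth_on (chart_image c) (\<lambda>x. \<omega> c x v)"
  unfolding forms_def by simp

lemma form_differentiable:
  "\<omega> \<in> forms \<A> k \<Longrightarrow> c \<in> \<A> \<Longrightarrow> x \<in> chart_image c \<Longrightarrow> (\<lambda>y. \<omega> c y v) differentiable (at x)"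
  using smooth_on_differentiable[OF form_smooth] .

lemma form_pullback:
  "\<omega> \<in> forms \<A> k \<Longrightarrow> c \<in> \<A> \<Longrightarrow> c' \<in> \<A> \<Longrightarrow> x \<in> overlap c c' \<Longrightarrow>
    \<omega> c x v = \<omega> c' (transition c c' x) (\<lambda>i. D (transition c c') x (v i))"
  unfolding forms_def by simp

lemma formsI:
  assumes "\<And>c x v. c \<notin> \<A> \<or> x \<notin> chart_image c \<Longrightarrow> \<omega> c x v = 0"
    and "\<And>c x. c \<in> \<A> \<Longrightarrow> x \<in> chart_image c \<Longrightarrow> \<omega> c x \<in> alternating_forms k"
    and "\<And>c v. c \<in> \<A> \<Longrightarrow> smooth_on (chart_image c) (\<lambda>x. \<omega> c x v)"
    and "\<And>c c' x v. c \<in> \<A> \<Longrightarrow> c' \<in> \<A> \<Longrightarrow> x \<in> overlap c c' \<Longrightarrow>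
      \<omega> c x v = \<omega> c' (transition c c' x) (\<lambda>i. D (transition c c') x (v i))"
  shows "\<omega> \<in> forms \<A> k"
  unfolding forms_def mem_Collect_eq using assms(2-4) by (intro conjI allI impI ballI ext assms(1))

lemma zero_form_in_forms: "zero_form \<in> forms \<A> k"
  by (rule formsI) (auto simp: zero_form_def zero_alternating smooth_on_const)

lemma ext_deriv_chart:
  "c \<in> \<A> \<Longrightarrow> x \<in> chart_image c \<Longrightarrow>
    ext_deriv \<A> k \<omega> c x v = (\<Sum>i\<le>k. (- 1) ^ i * D (\<lambda>y. \<omega> c y (omit i v)) x (v i))"
  by (simp add: ext_deriv_def)

text \<open>With the direction in slot 0 frozen, the derivative of the form is alternating in the
  other k arguments, so the bridge to \<open>alt\<close> applies.\<close>

lemma ext_deriv_eq_alt: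
  assumes "\<omega> \<in> forms \<A> k" "c \<in> \<A>" "x \<in> chart_image c"
  shows "ext_deriv \<A> k \<omega> c x v
    = alt (Suc k) (\<lambda>w. D (\<lambda>y. \<omega> c y (\<lambda>i. w (Suc i))) x (w 0)) v / fact k"
proof -
  have "(\<lambda>w. D (\<lambda>y. \<omega> c y w) x a) \<in> alternating_forms k" for a
    by (rule D_alternating) (auto intro: form_alternating form_differentiable assms)
  then show ?thesis
    using alternating_sum_eq_alt[of "\<lambda>w. D (\<lambda>y. \<omega> c y (\<lambda>i. w (Suc i))) x (w 0)" k v] assms
    by (simp add: ext_deriv_chart)
qed

lemma omit_upd_same: "omit i (v(i := u)) = omit i v"
  by (auto simp: omit_def)

lemma omit_upd_other: "i \<noteq> j \<Longrightarrow> omit i (v(j := u)) = (omit i v)((if j < i then j else j - 1) := u)"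
  by (auto simp: omit_def fun_eq_iff)

lemma ext_deriv_alternating:
  assumes \<omega>: "\<omega> \<in> forms \<A> k" and c: "c \<in> \<A>" and x: "x \<in> chart_image c"
  shows "ext_deriv \<A> k \<omega> c x \<in> alternating_forms (Suc k)"
proof -
  note [simp] = ext_deriv_chart[OF c x]
  have "ext_deriv \<A> k \<omega> c x v = ext_deriv \<A> k \<omega> c x w" if "\<forall>i<Suc k. v i = w i" for v w
  proof -
    have "\<omega> c y (omit i v) = \<omega> c y (omit i w)" for y i
      by (rule alternating_cong[OF form_alternating[OF \<omega>]]) (use that in \<open>auto simp: omit_def\<close>)
    then show ?thesis using that by simp
  qed
  moreover have "linear (\<lambda>u. ext_deriv \<A> k \<omega> c x (v(j := u)))" if "j < Suc k" for v j
  proof -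
    \<comment> \<open>If i = j, the varied vector is the direction of differentiation; otherwise it
      is an argument of the form, at position j or j - 1 after the omission.\<close>
    have "linear (\<lambda>u. (- 1) ^ i *\<^sub>R D (\<lambda>y. \<omega> c y (omit i (v(j := u)))) x ((v(j := u)) i))" if "i \<le> k" for i
    proof (rule linear_compose_scale_right, cases "i = j")
      case True
      then show "linear (\<lambda>u. D (\<lambda>y. \<omega> c y (omit i (v(j := u)))) x ((v(j := u)) i))"
        by (simp add: omit_upd_same linear_D form_differentiable[OF \<omega> c x])
    next
      case False
      have "(\<lambda>u. D (\<lambda>y. \<omega> c y u) x (v i)) \<in> alternating_forms k"
        by (rule D_alternating) (auto intro: form_alternating form_differentiable \<omega> c x)
      from alternating_linear[OF this, of "if j < i then j else j - 1" "omit i v"]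
      show "linear (\<lambda>u. D (\<lambda>y. \<omega> c y (omit i (v(j := u)))) x ((v(j := u)) i))"
        using False \<open>j < Suc k\<close> \<open>i \<le> k\<close> by (auto simp: omit_upd_other split: if_splits)
    qed
    then show ?thesis
      unfolding ext_deriv_chart[OF c x] by (intro linear_compose_sum) auto
  qed
  \<comment> \<open>Passing to \<open>alt\<close> avoids matching the two summands in which one of
    the equal vectors is omitted.\<close>
  moreover have "ext_deriv \<A> k \<omega> c x v = 0" if "i < Suc k" "j < Suc k" "i \<noteq> j" "v i = v j" for v i j
    using alt_eq_0_if_repeated[OF that] ext_deriv_eq_alt[OF assms] by simp
  ultimately show ?thesis
    unfolding alternating_forms_def mem_Collect_eq by (intro conjI allI impI) assumption+
qed

section \<open>Pullback and changes of charts\<close>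

lemma pullback_alternating:
  assumes f: "f \<in> alternating_forms k" and T: "linear T"
  shows "(\<lambda>v. f (\<lambda>i. T (v i))) \<in> alternating_forms k"
proof -
  have "f (\<lambda>i. T (v i)) = f (\<lambda>i. T (w i))" if "\<forall>i<k. v i = w i" for v w
    by (rule alternating_cong[OF f]) (use that in simp)
  moreover have "linear (\<lambda>u. f (\<lambda>i. T ((v(j := u)) i)))" if "j < k" for v j
  proof -
    have "(\<lambda>i. T ((v(j := u)) i)) = (\<lambda>i. T (v i))(j := T u)" for u by auto
    then show ?thesis
      using linear_compose[OF T alternating_linear[OF f that]] by (simp add: comp_def)
  qed
  moreover have "f (\<lambda>i. T (v i)) = 0" if "i < k" "j < k" "i \<noteq> j" "v i = v j" for v i j
    using alternating_repeated[OF f that(1-3)] that(4) by simp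
  ultimately show ?thesis
    unfolding alternating_forms_def mem_Collect_eq by (intro conjI allI impI) assumption+
qed

context smooth_atlas
begin

text \<open>The second derivatives of the transition map enter symmetrically, so their contribution is
  the antisymmetrization of a symmetric expression.\<close>

lemma ext_deriv_pullback:
  assumes \<omega>: "\<omega> \<in> forms \<A> k" and c: "c \<in> \<A>" "c' \<in> \<A>" and x: "x \<in> overlap c c'"
  shows "ext_deriv \<A> k \<omega> c x v
    = ext_deriv \<A> k \<omega> c' (transition c c' x) (\<lambda>i. D (transition c c') x (v i))"
proof -
  define \<tau> where "\<tau> = transition c c'"
  define T where "T = (\<lambda>h. D \<tau> x h)"
  define H where "H = (\<lambda>h u. D (\<lambda>y. D \<tau> y u) x h)"
  define \<Phi> where "\<Phi> = (\<lambda>y. \<omega> c' (\<tau> y))"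
  have O: "open (overlap c c')" and S: "smooth_on (overlap c c') \<tau>"
    unfolding \<tau>_def by (intro open_overlap smooth_transition c)+
  have xc: "x \<in> chart_image c" and xc': "\<tau> x \<in> chart_image c'"
    using overlap_subset[OF x] transition_in_chart_image[OF c(1) x] by (auto simp: \<tau>_def)
  have d\<tau>: "\<tau> differentiable (at x)"
    by (rule smooth_on_differentiable[OF S x])
  have linT: "linear T"
    unfolding T_def by (rule linear_D[OF d\<tau>])
  have d\<Phi>: "((\<lambda>y. \<Phi> y u) has_derivative (\<lambda>h. D (\<lambda>z. \<omega> c' z u) (\<tau> x) (T h))) (at x)" for u
    unfolding \<Phi>_def T_def
    by (rule has_derivative_compose[OF has_derivative_D[OF d\<tau>] has_derivative_D])
      (rule form_differentiable[OF \<omega> c(2) xc'])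
  \<comment> \<open>The pulled-back form depends on the point through its base point, which gives
    the first term, and through its arguments \<open>D \<tau> y (u i)\<close>, which give the terms
    with second derivatives.\<close>
  have step: "D (\<lambda>y. \<omega> c y u) x h = D (\<lambda>z. \<omega> c' z (\<lambda>i. T (u i))) (\<tau> x) (T h)
      + (\<Sum>j<k. \<Phi> x ((\<lambda>i. T (u i))(j := H h (u j))))" for u h
  proof -
    have "D (\<lambda>y. \<omega> c y u) x h = D (\<lambda>y. \<Phi> y (\<lambda>i. D \<tau> y (u i))) x h"
      by (rule D_cong_open[OF O x]) (simp add: form_pullback[OF \<omega> c] \<Phi>_def \<tau>_def)
    also have "\<dots> = D (\<lambda>y. \<Phi> y (\<lambda>i. D \<tau> x (u i))) x h
        + (\<Sum>j<k. \<Phi> x ((\<lambda>i. D \<tau> x (u i))(j := D (\<lambda>y. D \<tau> y (u j)) x h)))"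
    proof (rule D_eq, rule has_derivative_multilinear[OF finite_dimensional])
      show "\<Phi> y \<in> alternating_forms k" for y
        unfolding \<Phi>_def by (rule form_alternating[OF \<omega>])
      show "(\<lambda>y. \<Phi> y u) differentiable (at x)" for u
        using d\<Phi> unfolding differentiable_def by blast
      show "(\<lambda>y. D \<tau> y (u i)) differentiable (at x)" for i
        by (rule smooth_on_differentiable[OF smooth_on_D[OF S] x])
    qed
    finally show ?thesis
      using D_eq[OF d\<Phi>] by (simp add: T_def H_def)
  qed
  \<comment> \<open>The discrepancy between the two charts before antisymmetrization. Being
    alternating after slot 0, it can be passed through the bridge to \<open>alt\<close>.\<close>
  define R where "R = (\<lambda>w. D (\<lambda>y. \<omega> c y (\<lambda>i. w (Suc i))) x (w 0)
    - D (\<lambda>z. \<omega> c' z (\<lambda>i. T (w (Suc i)))) (\<tau> x) (T (w 0)))"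
  have R_alt: "(\<lambda>w. R (case_nat a w)) \<in> alternating_forms k" for a
  proof -
    have "(\<lambda>w. D (\<lambda>y. \<omega> c y w) x a) \<in> alternating_forms k"
      by (rule D_alternating) (auto intro: form_alternating form_differentiable \<omega> c xc)
    moreover have "(\<lambda>w. D (\<lambda>y. \<omega> c' y w) (\<tau> x) (T a)) \<in> alternating_forms k"
      by (rule D_alternating) (auto intro: form_alternating form_differentiable \<omega> c xc')
    from cmult_alternating[OF pullback_alternating[OF this linT], of "-1"]
    have "(\<lambda>w. - 1 * D (\<lambda>y. \<omega> c' y (\<lambda>i. T (w i))) (\<tau> x) (T a)) \<in> alternating_forms k" .
    ultimately show ?thesis
      using add_alternating by (fastforce simp: R_def)
  qed
  have "alt (Suc k) R v = (\<Sum>j<k. alt (Suc k) (\<lambda>w. \<Phi> x ((\<lambda>i. T (w (Suc i)))(j := H (w 0) (w (Suc j))))) v)"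
    unfolding R_def step by (simp add: alt_sum)
  also have "\<dots> = 0"
  proof (rule sum.neutral, rule ballI)
    fix j assume "j \<in> {..<k}"
    have H_sym: "H h u = H u h" for h u
      unfolding H_def by (rule second_derivative_commute_vector[OF finite_dimensional O x S])
    \<comment> \<open>\<open>w 0\<close> and \<open>w (Suc j)\<close> enter only through slot
      \<open>j\<close>, so exchanging them merely swaps the arguments of \<open>H\<close>.\<close>
    have "(\<lambda>i. T (w (Transposition.transpose 0 (Suc j) (Suc i))))(j := H (w (Suc j)) (w 0))
      = (\<lambda>i. T (w (Suc i)))(j := H (w 0) (w (Suc j)))" for w
      by (auto simp: fun_eq_iff H_sym[of "w 0"] Transposition.transpose_def)
    then show "alt (Suc k) (\<lambda>w. \<Phi> x ((\<lambda>i. T (w (Suc i)))(j := H (w 0) (w (Suc j))))) v = 0"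
      using \<open>j \<in> {..<k}\<close> by (intro alt_eq_0_if_symmetric[of 0 _ "Suc j"]) auto
  qed
  finally have "(\<Sum>i\<le>k. (- 1) ^ i * R (case_nat (v i) (omit i v))) = 0"
    using alternating_sum_eq_alt[of R, OF R_alt, of v] by simp
  then have "(\<Sum>i\<le>k. (- 1) ^ i * D (\<lambda>y. \<omega> c y (omit i v)) x (v i))
    = (\<Sum>i\<le>k. (- 1) ^ i * D (\<lambda>z. \<omega> c' z (\<lambda>j. T (omit i v j))) (\<tau> x) (T (v i)))"
    by (simp add: R_def right_diff_distrib sum_subtractf)
  moreover have "(\<lambda>j. T (omit i v j)) = omit i (\<lambda>j. T (v j))" for i
    by (auto simp: omit_def)
  ultimately show ?thesis
    using ext_deriv_chart[OF c(1) xc, of k \<omega> v] ext_deriv_chart[OF c(2) xc', of k \<omega> "\<lambda>i. T (v i)"]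
    by (simp add: T_def \<tau>_def)
qed

lemma ext_deriv_in_forms:
  assumes \<omega>: "\<omega> \<in> forms \<A> k"
  shows "ext_deriv \<A> k \<omega> \<in> forms \<A> (Suc k)"
proof (rule formsI)
  show "ext_deriv \<A> k \<omega> c x v = 0" if "c \<notin> \<A> \<or> x \<notin> chart_image c" for c x v
    using that by (auto simp: ext_deriv_def)
  show "ext_deriv \<A> k \<omega> c x \<in> alternating_forms (Suc k)" if "c \<in> \<A>" "x \<in> chart_image c" for c x
    using ext_deriv_alternating[OF \<omega> that] .
  show "smooth_on (chart_image c) (\<lambda>x. ext_deriv \<A> k \<omega> c x v)" if c: "c \<in> \<A>" for c v
  proof (rule smooth_on_cong[OF open_chart_image[OF c]])
    show "smooth_on (chart_image c) (\<lambda>x. \<Sum>i\<le>k. (- 1) ^ i * D (\<lambda>y. \<omega> c y (omit i v)) x (v i))"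
      by (intro smooth_on_sum smooth_on_mult smooth_on_const smooth_on_D form_smooth[OF \<omega> c] open_chart_image c)
  qed (simp add: ext_deriv_chart c)
  show "ext_deriv \<A> k \<omega> c x v
      = ext_deriv \<A> k \<omega> c' (transition c c' x) (\<lambda>i. D (transition c c') x (v i))"
    if "c \<in> \<A>" "c' \<in> \<A>" "x \<in> overlap c c'" for c c' x v
    using ext_deriv_pullback[OF \<omega> that] .
qed

lemma ext_deriv_ext_deriv:
  assumes \<omega>: "\<omega> \<in> forms \<A> k"
  shows "ext_deriv \<A> (Suc k) (ext_deriv \<A> k \<omega>) = zero_form"
proof (intro ext)
  fix c x v
  show "ext_deriv \<A> (Suc k) (ext_deriv \<A> k \<omega>) c x v = zero_form c x v"
  proof (cases "c \<in> \<A> \<and> x \<in> chart_image c")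
    case True
    then have c: "c \<in> \<A>" and x: "x \<in> chart_image c" by auto
    define P where "P = (\<lambda>y w. D (\<lambda>z. \<omega> c z (\<lambda>i. w (Suc i))) y (w 0))"
    have P: "(\<lambda>y. P y w) differentiable (at x)" for w
      unfolding P_def by (rule smooth_on_differentiable[OF smooth_on_D[OF form_smooth[OF \<omega> c]] x])
    have "D (\<lambda>y. ext_deriv \<A> k \<omega> c y u) x h = D (\<lambda>y. alt (Suc k) (P y) u) x h / fact k" for u h
    proof -
      have "D (\<lambda>y. ext_deriv \<A> k \<omega> c y u) x h = D (\<lambda>y. alt (Suc k) (P y) u / fact k) x h"
        by (rule D_cong_open[OF open_chart_image[OF c] x]) (simp add: ext_deriv_eq_alt[OF \<omega> c] P_def)
      then show ?thesis
        by (simp add: D_divide differentiable_alt P)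
    qed
    then have "ext_deriv \<A> (Suc k) (ext_deriv \<A> k \<omega>) c x v
      = alt (Suc (Suc k)) (\<lambda>w. D (\<lambda>y. P y (\<lambda>i. w (Suc i))) x (w 0)) v / fact k"
      by (simp add: ext_deriv_chart[OF c x] sum_D_alt[OF P] flip: sum_divide_distrib)
    also have "alt (Suc (Suc k)) (\<lambda>w. D (\<lambda>y. P y (\<lambda>i. w (Suc i))) x (w 0)) v = 0"
    \<comment> \<open>Slots 0 and 1 hold the directions of the outer and the inner
      derivative.\<close>
    proof (rule alt_eq_0_if_symmetric[of 0 _ 1])
      fix w :: "nat \<Rightarrow> 'e"
      show "D (\<lambda>y. P y (\<lambda>i. w (Transposition.transpose 0 1 (Suc i)))) x (w (Transposition.transpose 0 1 0))
        = D (\<lambda>y. P y (\<lambda>i. w (Suc i))) x (w 0)"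
        using second_derivative_commute[OF open_chart_image[OF c] x form_smooth[OF \<omega> c]]
        by (simp add: P_def Transposition.transpose_def)
    qed auto
    finally show ?thesis by (simp add: zero_form_def)
  next
    case False
    then show ?thesis by (auto simp: ext_deriv_def zero_form_def)
  qed
qed

end

section \<open>The wedge product\<close>

lemma wedge_eq_alt:
  "wedge p q \<alpha> \<beta> c x v
    = alt (p + q) (\<lambda>w. \<alpha> c x w * \<beta> c x (\<lambda>i. w (p + i))) v / (fact p * fact q)"
  by (simp add: wedge_def alt_def mult.assoc)

lemma alternating_product:
  assumes f: "f \<in> alternating_forms p" and g: "g \<in> alternating_forms q"
  shows "alt (p + q) (\<lambda>w. f w * g (\<lambda>i. w (p + i))) \<in> alternating_forms (p + q)"
    (is "?F \<in> _")
proof -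
  have "?F v = ?F w" if eq: "\<forall>i<p + q. v i = w i" for v w
    unfolding alt_def
  proof (intro sum.cong refl)
    fix \<sigma> assume "\<sigma> \<in> {\<sigma>. \<sigma> permutes {..<p + q}}"
    then have lt: "\<sigma> i < p + q" if "i < p + q" for i
      using that permutes_in_image[of \<sigma> "{..<p + q}" i] by simp
    have "f (\<lambda>i. v (\<sigma> i)) = f (\<lambda>i. w (\<sigma> i))"
      by (rule alternating_cong[OF f]) (use lt eq in auto)
    moreover have "g (\<lambda>i. v (\<sigma> (p + i))) = g (\<lambda>i. w (\<sigma> (p + i)))"
      by (rule alternating_cong[OF g]) (use lt eq in auto)
    ultimately show "of_int (sign \<sigma>) * (f (\<lambda>i. v (\<sigma> i)) * g (\<lambda>i. v (\<sigma> (p + i))))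
      = of_int (sign \<sigma>) * (f (\<lambda>i. w (\<sigma> i)) * g (\<lambda>i. w (\<sigma> (p + i))))" by simp
  qed
  moreover have "linear (\<lambda>u. ?F (v(j := u)))" if j: "j < p + q" for v j
    unfolding alt_def
  proof (intro linear_compose_sum ballI)
    fix \<sigma> assume "\<sigma> \<in> {\<sigma>. \<sigma> permutes {..<p + q}}"
    then have \<sigma>: "\<sigma> permutes {..<p + q}" by simp
    \<comment> \<open>The position of \<open>v j\<close> after permuting: a slot of \<open>f\<close>
      if m < p, and slot m - p of \<open>g\<close> otherwise.\<close>
    define m where "m = inv \<sigma> j"
    have m: "m < p + q"
      using permutes_in_image[OF permutes_inv[OF \<sigma>], of j] j by (simp add: m_def)
    have upd: "(v(j := u)) (\<sigma> i) = ((\<lambda>i. v (\<sigma> i))(m := u)) i" for u i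
      using permutes_inverses[OF \<sigma>] by (auto simp: m_def)
    have "linear (\<lambda>u. f ((\<lambda>i. v (\<sigma> i))(m := u)) * g (\<lambda>i. ((\<lambda>i. v (\<sigma> i))(m := u)) (p + i)))"
    proof (cases "m < p")
      case True
      then have g': "(\<lambda>i. ((\<lambda>i. v (\<sigma> i))(m := u)) (p + i)) = (\<lambda>i. v (\<sigma> (p + i)))" for u
        by auto
      have "linear (\<lambda>u. g (\<lambda>i. v (\<sigma> (p + i))) *\<^sub>R f ((\<lambda>i. v (\<sigma> i))(m := u)))"
        by (rule linear_compose_scale_right[OF alternating_linear[OF f True]])
      then show ?thesis
        unfolding g' by (simp only: real_scaleR_def mult.commute)
    next
      case False
      then have g': "(\<lambda>i. ((\<lambda>i. v (\<sigma> i))(m := u)) (p + i)) = (\<lambda>i. v (\<sigma> (p + i)))(m - p := u)" for u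
        by (auto simp: fun_eq_iff)
      have f': "f ((\<lambda>i. v (\<sigma> i))(m := u)) = f (\<lambda>i. v (\<sigma> i))" for u
        by (rule alternating_cong[OF f]) (use False in auto)
      have "m - p < q" using False m by simp
      then show ?thesis
        unfolding f' g' using linear_compose_scale_right[OF alternating_linear[OF g]] by fastforce
    qed
    from linear_compose_scale_right[OF this, of "of_int (sign \<sigma>)"]
    show "linear (\<lambda>u. of_int (sign \<sigma>) * (f (\<lambda>i. (v(j := u)) (\<sigma> i)) * g (\<lambda>i. (v(j := u)) (\<sigma> (p + i)))))"
      by (simp only: upd real_scaleR_def)
  qed
  moreover have "?F v = 0" if "i < p + q" "j < p + q" "i \<noteq> j" "v i = v j" for v i j
    using alt_eq_0_if_repeated[OF that] .
  ultimately show ?thesis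
    unfolding alternating_forms_def mem_Collect_eq by (intro conjI allI impI) assumption+
qed

lemma wedge_sum_right:
  "wedge p q \<alpha> (\<lambda>c x v. \<Sum>i\<in>I. a i * \<beta> i c x v) c x v = (\<Sum>i\<in>I. a i * wedge p q \<alpha> (\<beta> i) c x v)"
  unfolding wedge_eq_alt sum_distrib_left
  by (simp add: mult.left_commute[of "\<alpha> c x _"] alt_sum alt_cmult sum_divide_distrib)

lemma wedge_add_right:
  "wedge p q \<alpha> (\<lambda>c x v. \<beta> c x v + \<gamma> c x v) c x v = wedge p q \<alpha> \<beta> c x v + wedge p q \<alpha> \<gamma> c x v"
  unfolding wedge_eq_alt by (simp add: distrib_left alt_add add_divide_distrib)

lemma wedge_cmult_left: "wedge p q (\<lambda>c x v. a * \<alpha> c x v) \<beta> c x v = a * wedge p q \<alpha> \<beta> c x v"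
  unfolding wedge_eq_alt by (simp add: mult.assoc alt_cmult)

lemma wedge_zero_left [simp]: "wedge p q zero_form \<beta> c x v = 0"
  by (simp add: wedge_def zero_form_def)

lemma wedge_zero_right [simp]: "wedge p q \<alpha> zero_form c x v = 0"
  by (simp add: wedge_def zero_form_def)

lemma wedge_const_form:
  assumes "\<omega> \<in> forms \<A> k"
  shows "wedge 0 k (const_form \<A> a) \<omega> c x v = a * \<omega> c x v"
proof (cases "c \<in> \<A> \<and> x \<in> chart_image c")
  case True
  then show ?thesis
    by (simp add: wedge_eq_alt const_form_def alt_cmult alt_alternating[OF form_alternating[OF assms]])
next
  case False
  then show ?thesis
    using form_eq_0[OF assms, of c x] by (simp add: wedge_eq_alt alt_def)
qed

section \<open>Closure of forms under products and sums, and the Leibniz rule\<close>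

context smooth_atlas
begin

lemma wedge_in_forms:
  assumes \<alpha>: "\<alpha> \<in> forms \<A> p" and \<beta>: "\<beta> \<in> forms \<A> q"
  shows "wedge p q \<alpha> \<beta> \<in> forms \<A> (p + q)"
proof (rule formsI)
  show "wedge p q \<alpha> \<beta> c x v = 0" if "c \<notin> \<A> \<or> x \<notin> chart_image c" for c x v
    using form_eq_0[OF \<alpha> that] by (simp add: wedge_def)
  show "wedge p q \<alpha> \<beta> c x \<in> alternating_forms (p + q)" for c x
    using cmult_alternating[OF alternating_product[OF form_alternating[OF \<alpha>] form_alternating[OF \<beta>]],
        of "1 / (fact p * fact q)" c x c x]
    by (simp add: wedge_eq_alt[abs_def])
  show "smooth_on (chart_image c) (\<lambda>x. wedge p q \<alpha> \<beta> c x v)" if c: "c \<in> \<A>" for c v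
    unfolding wedge_def divide_inverse
    by (intro smooth_on_mult smooth_on_sum smooth_on_const form_smooth[OF \<alpha> c] form_smooth[OF \<beta> c] open_chart_image c)
  show "wedge p q \<alpha> \<beta> c x v
      = wedge p q \<alpha> \<beta> c' (transition c c' x) (\<lambda>i. D (transition c c') x (v i))"
    if "c \<in> \<A>" "c' \<in> \<A>" "x \<in> overlap c c'" for c c' x v
    unfolding wedge_def by (simp add: form_pullback[OF \<alpha> that] form_pullback[OF \<beta> that])
qed

text \<open>\<open>I\<close> is arbitrary because it will be \<open>Pow C\<close>; for infinite
  \<open>C\<close> the sum is 0 by convention and the result is the zero form.\<close>

lemma linear_combination_in_forms:
  assumes "\<And>i. i \<in> I \<Longrightarrow> \<omega> i \<in> forms \<A> k"
  shows "(\<lambda>c x v. \<Sum>i\<in>I. a i * \<omega> i c x v) \<in> forms \<A> k"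
proof (rule formsI)
  show "(\<Sum>i\<in>I. a i * \<omega> i c x v) = 0" if "c \<notin> \<A> \<or> x \<notin> chart_image c" for c x v
    using form_eq_0[OF assms that] by simp
  show "(\<lambda>v. \<Sum>i\<in>I. a i * \<omega> i c x v) \<in> alternating_forms k" for c x
    using assms
  proof (induction I rule: infinite_finite_induct)
    case (insert j I)
    have "(\<lambda>v. a j * \<omega> j c x v + (\<Sum>i\<in>I. a i * \<omega> i c x v)) \<in> alternating_forms k"
      by (rule add_alternating[OF cmult_alternating[OF form_alternating[where \<A> = \<A>]] insert.IH])
        (simp_all add: insert.prems)
    then show ?case using insert.hyps by simp
  qed (simp_all add: zero_alternating)
  show "smooth_on (chart_image c) (\<lambda>x. \<Sum>i\<in>I. a i * \<omega> i c x v)" if c: "c \<in> \<A>" for c v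
    by (intro smooth_on_mult smooth_on_sum smooth_on_const form_smooth[OF assms c] open_chart_image c)
  show "(\<Sum>i\<in>I. a i * \<omega> i c x v)
      = (\<Sum>i\<in>I. a i * \<omega> i c' (transition c c' x) (\<lambda>i. D (transition c c') x (v i)))"
    if "c \<in> \<A>" "c' \<in> \<A>" "x \<in> overlap c c'" for c c' x v
    by (intro sum.cong refl) (simp add: form_pullback[OF assms that])
qed

lemma add_in_forms:
  assumes "\<alpha> \<in> forms \<A> k" "\<beta> \<in> forms \<A> k"
  shows "(\<lambda>c x v. \<alpha> c x v + \<beta> c x v) \<in> forms \<A> k"
  \<comment> \<open>A binary sum is a linear combination indexed by \<open>bool\<close>.\<close>
  using linear_combination_in_forms[of "UNIV :: bool set" "\<lambda>b. if b then \<alpha> else \<beta>" k "\<lambda>_. 1"] assms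
  by (simp add: UNIV_bool add.commute)

lemma ext_deriv_linear_combination:
  assumes "\<And>i. i \<in> I \<Longrightarrow> \<omega> i \<in> forms \<A> k"
  shows "ext_deriv \<A> k (\<lambda>c x v. \<Sum>i\<in>I. a i * \<omega> i c x v) c x v = (\<Sum>i\<in>I. a i * ext_deriv \<A> k (\<omega> i) c x v)"
proof (cases "c \<in> \<A> \<and> x \<in> chart_image c")
  case True
  then have d: "(\<lambda>y. \<omega> i c y w) differentiable (at x)" if "i \<in> I" for i w
    using form_differentiable[OF assms[OF that]] by blast
  have "D (\<lambda>y. \<Sum>i\<in>I. a i * \<omega> i c y w) x h = (\<Sum>i\<in>I. a i * D (\<lambda>y. \<omega> i c y w) x h)" for w h
    by (simp add: D_sum D_cmult d)
  then show ?thesis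
    using True by (simp add: ext_deriv_chart sum_distrib_left mult.left_commute sum.swap[of _ I])
next
  case False
  then show ?thesis by (auto simp: ext_deriv_def)
qed

lemma ext_deriv_add:
  assumes "\<alpha> \<in> forms \<A> k" "\<beta> \<in> forms \<A> k"
  shows "ext_deriv \<A> k (\<lambda>c x v. \<alpha> c x v + \<beta> c x v) c x v = ext_deriv \<A> k \<alpha> c x v + ext_deriv \<A> k \<beta> c x v"
  using ext_deriv_linear_combination[of "UNIV :: bool set" "\<lambda>b. if b then \<alpha> else \<beta>" k "\<lambda>_. 1"] assms
  by (simp add: UNIV_bool add.commute)

text \<open>Both wedge products on the right are sums of cyclically reindexed copies of one
  expression, \<open>F\<close> or \<open>G\<close>. In the first the cycle signs cancel; in the
  second (-1)^p remains. The p + 1 or q + 1 equal terms reduce the larger factorial to the one on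
  the left.\<close>

lemma ext_deriv_wedge:
  assumes \<alpha>: "\<alpha> \<in> forms \<A> p" and \<beta>: "\<beta> \<in> forms \<A> q"
  shows "ext_deriv \<A> (p + q) (wedge p q \<alpha> \<beta>) c x v
    = wedge (Suc p) q (ext_deriv \<A> p \<alpha>) \<beta> c x v + (- 1) ^ p * wedge p (Suc q) \<alpha> (ext_deriv \<A> q \<beta>) c x v"
proof (cases "c \<in> \<A> \<and> x \<in> chart_image c")
  case True
  then have c: "c \<in> \<A>" and x: "x \<in> chart_image c" by auto
  note d\<alpha> = form_differentiable[OF \<alpha> c x] and d\<beta> = form_differentiable[OF \<beta> c x]
  define n where "n = p + q"
  define P where "P = (\<lambda>y w. \<alpha> c y w * \<beta> c y (\<lambda>i. w (p + i)))"
  have dP: "(\<lambda>y. P y w) differentiable (at x)" for w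
    unfolding P_def by (intro differentiable_mult d\<alpha> d\<beta>)
  \<comment> \<open>In \<open>F\<close> the derivative falls on \<alpha>, in \<open>G\<close> on
    \<beta>; in both, slot 0 is its direction.\<close>
  define F where "F = (\<lambda>w. D (\<lambda>y. \<alpha> c y (\<lambda>i. w (Suc i))) x (w 0) * \<beta> c x (\<lambda>i. w (Suc (p + i))))"
  define G where "G = (\<lambda>w. \<alpha> c x (\<lambda>i. w (Suc i)) * D (\<lambda>y. \<beta> c y (\<lambda>i. w (Suc (p + i)))) x (w 0))"
  have "D (\<lambda>y. wedge p q \<alpha> \<beta> c y u) x h = D (\<lambda>y. alt n (P y) u) x h / (fact p * fact q)" for u h
    using D_divide[of "\<lambda>y. alt n (P y) u" x "fact p * fact q" h] differentiable_alt[of P x n u] dP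
    by (simp add: wedge_eq_alt n_def P_def)
  then have "ext_deriv \<A> (p + q) (wedge p q \<alpha> \<beta>) c x v
    = alt (Suc n) (\<lambda>w. D (\<lambda>y. P y (\<lambda>i. w (Suc i))) x (w 0)) v / (fact p * fact q)"
    by (simp add: ext_deriv_chart[OF c x] sum_D_alt[OF dP] flip: sum_divide_distrib n_def)
  also have "(\<lambda>w. D (\<lambda>y. P y (\<lambda>i. w (Suc i))) x (w 0)) = (\<lambda>w. F w + G w)"
    unfolding P_def F_def G_def by (simp add: D_mult d\<alpha> d\<beta> fun_eq_iff)
  also have "alt (Suc n) \<dots> v = alt (Suc n) F v + alt (Suc n) G v"
    by (rule alt_add)
  finally have lhs: "ext_deriv \<A> (p + q) (wedge p q \<alpha> \<beta>) c x v
    = (alt (Suc n) F v + alt (Suc n) G v) / (fact p * fact q)" .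
  have signs: "(- 1 :: real) ^ (j + j) = 1" "(- 1 :: real) ^ (j + (p + j)) = (- 1) ^ p"
      "(- 1 :: real) ^ p * ((- 1) ^ p * a) = a" for j a
    by (simp_all add: minus_one_power_iff)
  have cycle: "alt (Suc n) (\<lambda>w. (- 1) ^ j * K (case_nat (w m) (omit m w))) v = (- 1) ^ (j + m) * alt (Suc n) K v"
    if "m \<le> n" for m j K
    using alt_permute[OF cycle_to_permutes, of m "Suc n" K v] that
    by (simp add: permute_cycle_to sign_cycle_to alt_cmult power_add)
  have "(\<lambda>w. ext_deriv \<A> p \<alpha> c x w * \<beta> c x (\<lambda>i. w (Suc p + i)))
    = (\<lambda>w. \<Sum>j\<le>p. (- 1) ^ j * F (case_nat (w j) (omit j w)))"
  proof
    fix w :: "nat \<Rightarrow> 'e"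
    have "(\<lambda>i. omit j w (p + i)) = (\<lambda>i. w (Suc (p + i)))" if "j \<le> p" for j
      using that by (auto simp: omit_def)
    then show "ext_deriv \<A> p \<alpha> c x w * \<beta> c x (\<lambda>i. w (Suc p + i))
      = (\<Sum>j\<le>p. (- 1) ^ j * F (case_nat (w j) (omit j w)))"
      by (simp add: ext_deriv_chart[OF c x] F_def sum_distrib_right mult.assoc)
  qed
  then have "wedge (Suc p) q (ext_deriv \<A> p \<alpha>) \<beta> c x v
    = (\<Sum>j\<le>p. alt (Suc n) (\<lambda>w. (- 1) ^ j * F (case_nat (w j) (omit j w))) v) / (fact (Suc p) * fact q)"
    by (simp only: wedge_eq_alt alt_sum n_def add_Suc)
  also have "\<dots> = (\<Sum>j\<le>p. (- 1) ^ (j + j) * alt (Suc n) F v) / (fact (Suc p) * fact q)"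
    by (intro arg_cong2[where f = "(/)"] sum.cong refl cycle) (simp add: n_def)
  also have "\<dots> = alt (Suc n) F v / (fact p * fact q)"
    by (simp add: signs divide_simps del: of_nat_Suc)
  finally have 1: "wedge (Suc p) q (ext_deriv \<A> p \<alpha>) \<beta> c x v = alt (Suc n) F v / (fact p * fact q)" .
  have "(\<lambda>w. \<alpha> c x w * ext_deriv \<A> q \<beta> c x (\<lambda>i. w (p + i)))
    = (\<lambda>w. \<Sum>j\<le>q. (- 1) ^ j * G (case_nat (w (p + j)) (omit (p + j) w)))"
  proof
    fix w :: "nat \<Rightarrow> 'e"
    have "(\<lambda>i. omit (p + j) w (p + i)) = omit j (\<lambda>i. w (p + i))" for j
      by (auto simp: omit_def)
    \<comment> \<open>Omitting slot p + j leaves the first p slots, on which alone \<alpha> depends,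
      in place.\<close>
    moreover have "\<alpha> c x (omit (p + j) w) = \<alpha> c x w" for j
      by (rule alternating_cong[OF form_alternating[OF \<alpha>]]) (auto simp: omit_def)
    ultimately show "\<alpha> c x w * ext_deriv \<A> q \<beta> c x (\<lambda>i. w (p + i))
      = (\<Sum>j\<le>q. (- 1) ^ j * G (case_nat (w (p + j)) (omit (p + j) w)))"
      by (simp add: ext_deriv_chart[OF c x] G_def sum_distrib_left mult.left_commute)
  qed
  then have "wedge p (Suc q) \<alpha> (ext_deriv \<A> q \<beta>) c x v
    = (\<Sum>j\<le>q. alt (Suc n) (\<lambda>w. (- 1) ^ j * G (case_nat (w (p + j)) (omit (p + j) w))) v) / (fact p * fact (Suc q))"
    by (simp only: wedge_eq_alt alt_sum n_def add_Suc_right)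
  also have "\<dots> = (\<Sum>j\<le>q. (- 1) ^ (j + (p + j)) * alt (Suc n) G v) / (fact p * fact (Suc q))"
    by (intro arg_cong2[where f = "(/)"] sum.cong refl cycle) (simp add: n_def)
  also have "\<dots> = (\<Sum>j\<le>q. (- 1) ^ p * alt (Suc n) G v) / (fact p * fact (Suc q))"
    by (simp only: signs)
  also have "\<dots> = (- 1) ^ p * alt (Suc n) G v / (fact p * fact q)"
    by (simp add: divide_simps del: of_nat_Suc)
  finally have 2: "wedge p (Suc q) \<alpha> (ext_deriv \<A> q \<beta>) c x v = (- 1) ^ p * alt (Suc n) G v / (fact p * fact q)" .
  show ?thesis
    unfolding lhs 1 2 by (simp add: add_divide_distrib signs)
next
  case False
  then have "\<beta> c x = (\<lambda>v. 0)" "\<alpha> c x = (\<lambda>v. 0)"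
    using form_eq_0[OF \<beta>, of c x] form_eq_0[OF \<alpha>, of c x] by auto
  then show ?thesis
    using False by (auto simp: ext_deriv_def wedge_def)
qed

end

section \<open>The twisted differential\<close>

lemma reorder_sign_empty [simp]: "reorder_sign A {} = 1"
  by (simp add: reorder_sign_def)

lemma reorder_sign_Un:
  assumes "finite A" "finite B" "finite R" "B \<inter> R = {}"
  shows "reorder_sign A (B \<union> R) = reorder_sign A B * reorder_sign A R"
proof -
  have fin: "finite {(a, b). a \<in> A \<and> b \<in> X \<and> b < a}" if "finite X" for X
    by (rule finite_subset[of _ "A \<times> X"]) (use assms that in auto)
  have "{(a, b). a \<in> A \<and> b \<in> B \<union> R \<and> b < a}
    = {(a, b). a \<in> A \<and> b \<in> B \<and> b < a} \<union> {(a, b). a \<in> A \<and> b \<in> R \<and> b < a}"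
    by auto
  moreover have "{(a, b). a \<in> A \<and> b \<in> B \<and> b < a} \<inter> {(a, b). a \<in> A \<and> b \<in> R \<and> b < a} = {}"
    using assms(4) by auto
  ultimately show ?thesis
    using assms by (simp add: reorder_sign_def card_Un_disjoint fin power_add)
qed

text \<open>For disjoint sets every pair in A \<times> B is an inversion for exactly one of the two
  orders, so the two inversion counts add up to \<open>card A * card B\<close>.\<close>

lemma reorder_sign_commute:
  fixes A B :: "'g::linorder set"
  assumes "finite A" "finite B" "A \<inter> B = {}"
  shows "reorder_sign B A = (- 1) ^ (card A * card B) * reorder_sign A B"
proof -
  let ?X = "{(a, b). a \<in> A \<and> b \<in> B \<and> b < a}" and ?Y = "{(b, a). b \<in> B \<and> a \<in> A \<and> a < b}"
  have fin: "finite ?X" "finite ?Y"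
    using assms by (auto intro: finite_subset[of _ "A \<times> B"] finite_subset[of _ "B \<times> A"])
  have "A \<times> B = ?X \<union> prod.swap ` ?Y"
    using assms(3) by (auto simp: image_def neq_iff)
  then have "card (A \<times> B) = card (?X \<union> prod.swap ` ?Y)"
    by (rule arg_cong)
  also have "\<dots> = card ?X + card (prod.swap ` ?Y)"
    by (rule card_Un_disjoint) (use fin in auto)
  finally have "card A * card B = card ?X + card ?Y"
    by (simp add: card_image card_cartesian_product)
  then show ?thesis
    by (simp add: reorder_sign_def minus_one_power_iff)
qed

text \<open>Multiplication by \<open>r * G\<close> for an odd Grassmann element \<open>r\<close> and a \<open>k\<close>-form \<open>G\<close> with \<open>k\<close>
  even: the sign \<open>(- 1) ^ (card A * (n - k))\<close> of the product reduces to \<open>(- 1) ^ n\<close>.\<close>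

definition odd_mult ::
  "('g::linorder set \<Rightarrow> real) \<Rightarrow> nat \<Rightarrow> ('a, 'e) dform \<Rightarrow> ('a, 'e, 'g) gform \<Rightarrow> ('a, 'e, 'g) gform"
where
  "odd_mult r k G \<Phi> = (\<lambda>C n c x w. if k \<le> n then
     \<Sum>A\<in>Pow C. ((- 1) ^ n * r A * reorder_sign A (C - A)) * wedge k (n - k) G (\<Phi> (C - A) (n - k)) c x w
     else 0)"

text \<open>Only \<open>A = C\<close> and \<open>p = 0\<close> contribute, and the sign (-1)^(card C
  * k) is 1 for even \<open>k\<close>.\<close>

lemma gmult_of_grassmann_of_form:
  assumes r: "r \<in> grassmann S" and G: "G \<in> forms \<A> k" and k: "even k"
  shows "gmult (of_grassmann \<A> r) (of_form k G) C n = (if n = k then \<lambda>c x w. r C * G c x w else zero_form)"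
proof (intro ext)
  fix c x w
  let ?t = "\<lambda>A p. (- 1) ^ (card A * (n - p)) * reorder_sign A (C - A) *
       wedge p (n - p) (of_grassmann \<A> r A p) (of_form k G (C - A) (n - p)) c x w"
  let ?rhs = "(if n = k then \<lambda>c x w. r C * G c x w else zero_form) c x w"
  have t: "?t A p = (if p = 0 then if A = C then ?rhs else 0 else 0)" if "A \<in> Pow C" for A p
  proof (cases "p = 0 \<and> A = C \<and> n = k")
    case True
    then show ?thesis
      using k by (simp add: of_grassmann_def of_form_def wedge_const_form[OF G])
  next
    case False
    then have "of_grassmann \<A> r A p = zero_form \<or> of_form k G (C - A) (n - p) = zero_form"
      using that by (auto simp: of_grassmann_def of_form_def)
    then show ?thesis
      using False by (auto simp: zero_form_def[symmetric]) (auto simp: zero_form_def)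
  qed
  have "gmult (of_grassmann \<A> r) (of_form k G) C n c x w = (\<Sum>A\<in>Pow C. \<Sum>p\<le>n. ?t A p)"
    by (simp add: gmult_def)
  also have "\<dots> = (\<Sum>A\<in>Pow C. if A = C then ?rhs else 0)"
    by (rule sum.cong[OF refl]) (simp only: t sum.delta finite_atMost atMost_iff le0 if_True)
  also have "\<dots> = ?rhs"
  proof (cases "finite C")
    case True
    then show ?thesis by simp
  next
    \<comment> \<open>For infinite \<open>C\<close> the sum over the infinite set
      \<open>Pow C\<close> is 0, which agrees with \<open>r C = 0\<close>.\<close>
    case False
    then have "r C = 0"
      using r unfolding grassmann_def by blast
    then show ?thesis
      using False by (simp add: zero_form_def finite_Pow_iff)
  qed
  finally show "gmult (of_grassmann \<A> r) (of_form k G) C n c x w = ?rhs" .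
qed

lemma gmult_eq_odd_mult:
  assumes r: "r \<in> grassmann S" "grassmann_odd r" and G: "G \<in> forms \<A> k" and k: "even k"
  shows "gmult (gmult (of_grassmann \<A> r) (of_form k G)) \<Phi> = odd_mult r k G \<Phi>"
proof (intro ext)
  fix C n c x w
  have "(\<Sum>p\<le>n. (- 1) ^ (card A * (n - p)) * reorder_sign A (C - A) *
      wedge p (n - p) (gmult (of_grassmann \<A> r) (of_form k G) A p) (\<Phi> (C - A) (n - p)) c x w)
    = (\<Sum>p\<le>n. if p = k then ((- 1) ^ n * r A * reorder_sign A (C - A)) *
        wedge k (n - k) G (\<Phi> (C - A) (n - k)) c x w else 0)" for A
  proof (rule sum.cong[OF refl])
    fix p assume "p \<in> {..n}"
    \<comment> \<open>A nonzero \<open>r A\<close> forces \<open>card A\<close> to be odd, and n - k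
      has the parity of n.\<close>
    have sign: "(- 1) ^ (card A * (n - k)) * r A = (- 1) ^ n * r A" if "k \<le> n"
      using r(2) k that by (cases "r A = 0") (auto simp: grassmann_odd_def minus_one_power_iff)
    show "(- 1) ^ (card A * (n - p)) * reorder_sign A (C - A) *
      wedge p (n - p) (gmult (of_grassmann \<A> r) (of_form k G) A p) (\<Phi> (C - A) (n - p)) c x w
    = (if p = k then ((- 1) ^ n * r A * reorder_sign A (C - A)) *
        wedge k (n - k) G (\<Phi> (C - A) (n - k)) c x w else 0)"
      using sign \<open>p \<in> {..n}\<close>
      by (auto simp: gmult_of_grassmann_of_form[OF r(1) G k] wedge_cmult_left)
  qed
  then show "gmult (gmult (of_grassmann \<A> r) (of_form k G)) \<Phi> C n c x w = odd_mult r k G \<Phi> C n c x w"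
    by (simp add: gmult_def[of "gmult _ _"] odd_mult_def)
qed

lemma odd_mult_gadd:
  "odd_mult r k G (gadd \<Phi> \<Psi>) C n c x w = odd_mult r k G \<Phi> C n c x w + odd_mult r k G \<Psi> C n c x w"
  by (simp add: odd_mult_def gadd_def wedge_add_right distrib_left sum.distrib)

lemma odd_mult_odd_mult:
  assumes r: "r \<in> grassmann S" "grassmann_odd r" and k: "even k"
  shows "odd_mult r k G (odd_mult r k G \<Phi>) C n c x w = 0"
proof (cases "finite C \<and> k \<le> n")
  case True
  then have C: "finite C" and n: "k \<le> n" by auto
  \<comment> \<open>The factor made of forms depends on \<open>A\<close> and \<open>B\<close> only
    through what remains of \<open>C\<close>, so it is unaffected by exchanging them.\<close>
  define X where "X = (\<lambda>E. if k \<le> n - k then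
    wedge k (n - k) G (wedge k (n - k - k) G (\<Phi> E (n - k - k))) c x w else 0)"
  define h where "h = (\<lambda>A B. r A * r B * reorder_sign A (C - A) * reorder_sign B (C - A - B) * X (C - A - B))"
  have inner: "wedge k (n - k) G (odd_mult r k G \<Phi> E (n - k)) c x w
    = (\<Sum>B\<in>Pow E. ((- 1) ^ (n - k) * r B * reorder_sign B (E - B)) * X (E - B))" for E
  proof (cases "k \<le> n - k")
    case True
    then have "odd_mult r k G \<Phi> E (n - k) = (\<lambda>c x w. \<Sum>B\<in>Pow E.
        ((- 1) ^ (n - k) * r B * reorder_sign B (E - B)) * wedge k (n - k - k) G (\<Phi> (E - B) (n - k - k)) c x w)"
      by (simp add: odd_mult_def)
    then show ?thesis
      using True by (simp add: wedge_sum_right X_def)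
  next
    case False
    then have "odd_mult r k G \<Phi> E (n - k) = zero_form"
      by (simp add: odd_mult_def zero_form_def)
    then show ?thesis
      using False by (simp add: X_def)
  qed
  have "odd_mult r k G (odd_mult r k G \<Phi>) C n c x w
    = (\<Sum>A\<in>Pow C. \<Sum>B\<in>Pow (C - A). ((- 1) ^ n * (- 1) ^ (n - k)) * h A B)"
    using n unfolding odd_mult_def[of r k G "odd_mult r k G \<Phi>"] inner h_def
    by (simp add: sum_distrib_left mult_ac)
  also have "\<dots> = ((- 1) ^ n * (- 1) ^ (n - k)) * (\<Sum>(A, B)\<in>(SIGMA A:Pow C. Pow (C - A)). h A B)"
    using C by (simp add: sum.Sigma flip: sum_distrib_left)
  also have "(\<Sum>(A, B)\<in>(SIGMA A:Pow C. Pow (C - A)). h A B) = 0"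
  proof -
    let ?I = "SIGMA A:Pow C. Pow (C - A)"
    have anti: "h B A = - h A B" if "A \<subseteq> C" "B \<subseteq> C - A" for A B
    proof (cases "r A = 0 \<or> r B = 0")
      case True
      then show ?thesis by (auto simp: h_def)
    next
      case False
      then have odd: "odd (card A)" "odd (card B)"
        using r(2) by (auto simp: grassmann_odd_def)
      define R where "R = C - A - B"
      have fin: "finite A" "finite B" "finite R"
        using that C by (auto simp: R_def intro: finite_subset)
      have eq: "C - A = B \<union> R" "C - B = A \<union> R" "C - B - A = R" and dis: "B \<inter> R = {}" "A \<inter> R = {}" "A \<inter> B = {}"
        using that by (auto simp: R_def)
      \<comment> \<open>Split along B \<union> R, the signs become the product of those for (A, B),
        (A, R) and (B, R); the exchange affects only the first.\<close>
      have "reorder_sign B A = - reorder_sign A B"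
        using reorder_sign_commute[OF fin(1,2) dis(3)] odd by simp
      then show ?thesis
        unfolding h_def eq(3) R_def[symmetric] unfolding eq
        by (simp add: reorder_sign_Un fin dis)
    qed
    have "(\<Sum>(A, B)\<in>?I. h A B) = (\<Sum>(A, B)\<in>?I. h B A)"
      by (rule sum.reindex_bij_witness[where i = prod.swap and j = prod.swap]) auto
    also have "\<dots> = (\<Sum>(A, B)\<in>?I. - h A B)"
      by (rule sum.cong) (auto intro: anti)
    also have "\<dots> = - (\<Sum>(A, B)\<in>?I. h A B)"
      by (simp add: split_def sum_negf)
    finally show ?thesis by simp
  qed
  finally show ?thesis by simp
next
  \<comment> \<open>The first sum is over the infinite set \<open>Pow C\<close>, hence 0 by
    convention, or the degree is below \<open>k\<close>.\<close>
  case False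
  then show ?thesis by (auto simp: odd_mult_def finite_Pow_iff)
qed

section \<open>Anticommutation with d, and the square of the twisted operator\<close>

context smooth_atlas
begin

lemma odd_mult_in_forms:
  assumes G: "G \<in> forms \<A> k" and \<Phi>: "\<And>A n. \<Phi> A n \<in> forms \<A> n"
  shows "odd_mult r k G \<Phi> C n \<in> forms \<A> n"
proof (cases "k \<le> n")
  case True
  then have "wedge k (n - k) G (\<Phi> A (n - k)) \<in> forms \<A> n" for A
    using wedge_in_forms[OF G \<Phi>[of A "n - k"]] by simp
  from linear_combination_in_forms[OF this] show ?thesis
    unfolding odd_mult_def using True by simp
next
  case False
  then show ?thesis
    using zero_form_in_forms[of \<A> n] by (simp add: odd_mult_def zero_form_def)
qed

lemma de_rham_in_forms:
  "(\<And>A n. \<Phi> A n \<in> forms \<A> n) \<Longrightarrow> de_rham \<A> \<Phi> C n \<in> forms \<A> n"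
  by (cases n) (simp_all add: de_rham_def zero_form_in_forms ext_deriv_in_forms)

lemma ext_deriv_zero_form [simp]: "ext_deriv \<A> k zero_form = zero_form"
  by (auto simp: ext_deriv_def zero_form_def fun_eq_iff)

text \<open>Since \<open>G\<close> is closed of even degree, d passes through G \<and> without a
  sign. The minus sign is the quotient of the factors (-1)^m and (-1)^(m+1) built into
  \<open>odd_mult\<close>.\<close>

lemma ext_deriv_odd_mult:
  assumes G: "G \<in> forms \<A> k" "ext_deriv \<A> k G = zero_form" and k: "even k" and \<Phi>: "\<And>A n. \<Phi> A n \<in> forms \<A> n"
  shows "ext_deriv \<A> m (odd_mult r k G \<Phi> C m) c x w = - odd_mult r k G (de_rham \<A> \<Phi>) C (Suc m) c x w"
proof (cases "k \<le> m")
  case True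
  have W: "wedge k (m - k) G (\<Phi> A (m - k)) \<in> forms \<A> m" for A
    using wedge_in_forms[OF G(1) \<Phi>[of A "m - k"]] True by simp
  have dW: "ext_deriv \<A> m (wedge k (m - k) G (\<Phi> A (m - k))) c x w
      = wedge k (Suc m - k) G (de_rham \<A> \<Phi> A (Suc m - k)) c x w" for A
    using ext_deriv_wedge[OF G(1) \<Phi>[of A "m - k"], of c x w] True k G(2)
    by (simp add: de_rham_def Suc_diff_le)
  have "ext_deriv \<A> m (odd_mult r k G \<Phi> C m) c x w
    = (\<Sum>A\<in>Pow C. ((- 1) ^ m * r A * reorder_sign A (C - A)) *
        wedge k (Suc m - k) G (de_rham \<A> \<Phi> (C - A) (Suc m - k)) c x w)"
    using True ext_deriv_linear_combination[OF W, where I = "Pow C"] by (simp add: odd_mult_def dW)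
  then show ?thesis
    using True by (simp add: odd_mult_def sum_negf)
next
  case False
  then have "odd_mult r k G \<Phi> C m = zero_form"
    by (simp add: odd_mult_def zero_form_def)
  \<comment> \<open>The borderline case is k = m + 1, where \<open>G\<close> would multiply the
    degree 0 part of d\<Phi>, which is zero.\<close>
  moreover have "odd_mult r k G (de_rham \<A> \<Phi>) C (Suc m) c x w = 0"
    using False by (auto simp: odd_mult_def de_rham_def le_Suc_eq)
  ultimately show ?thesis
    by (simp only: ext_deriv_zero_form) (simp add: zero_form_def)
qed

lemma twisted_in_gforms:
  assumes r: "r \<in> grassmann S" and G: "G \<in> forms \<A> k" and \<Phi>: "\<Phi> \<in> gforms \<A> S"
  shows "gadd (de_rham \<A> \<Phi>) (odd_mult r k G \<Phi>) \<in> gforms \<A> S" (is "?T \<in> _")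
proof -
  have comp: "\<Phi> A n \<in> forms \<A> n" and supp: "\<Phi> A n \<noteq> zero_form \<Longrightarrow> finite A \<and> A \<subseteq> S" for A n
    using \<Phi> unfolding gforms_def mem_Collect_eq by blast+
  have fin: "finite {(A, n). \<Phi> A n \<noteq> zero_form}"
    using \<Phi> unfolding gforms_def mem_Collect_eq by blast
  have r_supp: "finite A \<and> A \<subseteq> S" if "r A \<noteq> 0" for A
    using r that unfolding grassmann_def mem_Collect_eq by blast
  have r_fin: "finite {A. r A \<noteq> 0}"
    using r unfolding grassmann_def mem_Collect_eq by blast
  \<comment> \<open>A finite set containing the support of the result: d raises the form degree by
    one, and multiplication unites a generator set from \<open>r\<close> with one from \<Phi> and
    raises the degree by \<open>k\<close>.\<close>
  define N where "N = (\<lambda>(A, n). (A, Suc n)) ` {(A, n). \<Phi> A n \<noteq> zero_form}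
    \<union> (\<lambda>(A, (B, n)). (A \<union> B, k + n)) ` ({A. r A \<noteq> 0} \<times> {(B, n). \<Phi> B n \<noteq> zero_form})"
  have "finite N"
    unfolding N_def by (intro finite_UnI finite_imageI finite_cartesian_product fin r_fin)
  have N: "(C, n) \<in> N" if T: "?T C n \<noteq> zero_form" for C n
  proof (rule ccontr)
    assume notN: "(C, n) \<notin> N"
    have "de_rham \<A> \<Phi> C n = zero_form"
    proof (cases n)
      case (Suc m)
      then have "\<Phi> C m = zero_form"
        using notN by (force simp: N_def image_def)
      then show ?thesis using Suc by (simp add: de_rham_def)
    qed (simp add: de_rham_def)
    moreover have "odd_mult r k G \<Phi> C n c x w = 0" for c x w
    proof (cases "k \<le> n")
      case True
      have coeff: "r A = 0 \<or> \<Phi> (C - A) (n - k) = zero_form" if "A \<in> Pow C" for A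
      proof (rule ccontr)
        assume "\<not> ?thesis"
        then have "(A \<union> (C - A), k + (n - k)) \<in> N"
          unfolding N_def by (intro UnI2 image_eqI[of _ _ "(A, (C - A, n - k))"]) auto
        moreover have "A \<union> (C - A) = C" using that by auto
        ultimately show False using notN True by simp
      qed
      have "(\<Sum>A\<in>Pow C. ((- 1) ^ n * r A * reorder_sign A (C - A)) *
          wedge k (n - k) G (\<Phi> (C - A) (n - k)) c x w) = 0"
      proof (rule sum.neutral, rule ballI)
        fix A assume "A \<in> Pow C"
        from coeff[OF this]
        show "((- 1) ^ n * r A * reorder_sign A (C - A)) * wedge k (n - k) G (\<Phi> (C - A) (n - k)) c x w = 0"
          by (elim disjE) simp_all
      qed
      then show ?thesis
        by (simp only: odd_mult_def True if_True)
    qed (simp add: odd_mult_def)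
    ultimately show False
      using T by (simp add: gadd_def zero_form_def)
  qed
  have "finite {(C, n). ?T C n \<noteq> zero_form}"
    by (rule finite_subset[OF _ \<open>finite N\<close>]) (use N in auto)
  moreover have "finite C \<and> C \<subseteq> S" if "?T C n \<noteq> zero_form" for C n
  proof -
    from N[OF that] have "(\<exists>m. \<Phi> C m \<noteq> zero_form) \<or>
        (\<exists>A B m. C = A \<union> B \<and> r A \<noteq> 0 \<and> \<Phi> B m \<noteq> zero_form)"
      unfolding N_def Un_iff
    proof (elim disjE imageE, goal_cases)
      case (1 p)
      then show ?case by (cases p) auto
    next
      case (2 p)
      then show ?case by (cases p) auto
    qed
    then show ?thesis
    proof (elim disjE exE conjE)
      fix m assume "\<Phi> C m \<noteq> zero_form"
      then show ?thesis by (rule supp)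
    next
      fix A B m assume *: "C = A \<union> B" "r A \<noteq> 0" "\<Phi> B m \<noteq> zero_form"
      show ?thesis using r_supp[OF *(2)] supp[OF *(3)] *(1) by simp
    qed
  qed
  moreover have "?T C n \<in> forms \<A> n" for C n
    unfolding gadd_def by (intro add_in_forms de_rham_in_forms odd_mult_in_forms comp G)
  ultimately show ?thesis
    unfolding gforms_def by blast
qed

lemma twisted_squared:
  assumes r: "r \<in> grassmann S" "grassmann_odd r"
    and G: "G \<in> forms \<A> k" "ext_deriv \<A> k G = zero_form" and k: "even k" "k > 0"
    and \<Phi>: "\<And>A n. \<Phi> A n \<in> forms \<A> n"
  shows "gadd (de_rham \<A> (gadd (de_rham \<A> \<Phi>) (odd_mult r k G \<Phi>)))
    (odd_mult r k G (gadd (de_rham \<A> \<Phi>) (odd_mult r k G \<Phi>))) = gzero"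
proof (intro ext)
  fix C n c x w
  let ?\<Psi> = "gadd (de_rham \<A> \<Phi>) (odd_mult r k G \<Phi>)"
  \<comment> \<open>The square of the multiplication drops out here; what remains is to be cancelled
    by d of the product.\<close>
  have M: "odd_mult r k G ?\<Psi> C n c x w = odd_mult r k G (de_rham \<A> \<Phi>) C n c x w"
    by (simp add: odd_mult_gadd odd_mult_odd_mult[OF r k(1)])
  have "de_rham \<A> ?\<Psi> C n c x w + odd_mult r k G (de_rham \<A> \<Phi>) C n c x w = 0"
  proof (cases n)
    \<comment> \<open>In degree 0 the de Rham part is zero by definition and the product vanishes
      because k > 0.\<close>
    case 0
    then show ?thesis
      using k(2) by (simp add: de_rham_def odd_mult_def zero_form_def)
  next
    case (Suc m)
    have "ext_deriv \<A> m (de_rham \<A> \<Phi> C m) = zero_form"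
      by (cases m) (simp_all add: de_rham_def ext_deriv_ext_deriv \<Phi>)
    moreover have "ext_deriv \<A> m (?\<Psi> C m) c x w
      = ext_deriv \<A> m (de_rham \<A> \<Phi> C m) c x w + ext_deriv \<A> m (odd_mult r k G \<Phi> C m) c x w"
      unfolding gadd_def
      by (rule ext_deriv_add[OF de_rham_in_forms odd_mult_in_forms]) (rule \<Phi> G)+
    ultimately show ?thesis
      using Suc by (simp add: de_rham_def[of \<A> ?\<Psi>] ext_deriv_odd_mult[OF G k(1) \<Phi>] zero_form_def)
  qed
  then show "gadd (de_rham \<A> ?\<Psi>) (odd_mult r k G ?\<Psi>) C n c x w = gzero C n c x w"
    by (simp add: gadd_def[of "de_rham \<A> ?\<Psi>"] M gzero_def zero_form_def)
qed

end

theorem proposition5p3: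
  fixes Y :: "'a topology"
    and \<A> :: "('a, 'e::real_normed_vector) chart set"
    and S :: "'g::linorder set"
    and v :: "'g set \<Rightarrow> real"
    and G :: "('a, 'e) dform"
    and i :: nat
  assumes "smooth_manifold Y \<A>"
    and "i \<ge> 1"
    and "G \<in> forms \<A> (2 * i)"
    and "ext_deriv \<A> (2 * i) G = zero_form"
    and "v \<in> grassmann S"
    and "grassmann_odd v"
  shows "\<forall>\<Phi>\<in>gforms \<A> S.
           twisted_de_rham \<A> v (2 * i) G \<Phi> \<in> gforms \<A> S \<and>
           twisted_de_rham \<A> v (2 * i) G (twisted_de_rham \<A> v (2 * i) G \<Phi>) = gzero"
proof -
  interpret smooth_atlas Y \<A>
    by standard (rule assms(1))
  have T: "twisted_de_rham \<A> v (2 * i) G \<Phi> = gadd (de_rham \<A> \<Phi>) (odd_mult v (2 * i) G \<Phi>)"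
    for \<Phi> :: "('a, 'e, 'g) gform"
    unfolding twisted_de_rham_def using gmult_eq_odd_mult[OF assms(5,6,3)] by simp
  have "\<Phi> A n \<in> forms \<A> n" if "\<Phi> \<in> gforms \<A> S" for \<Phi> :: "('a, 'e, 'g) gform" and A n
    using that unfolding gforms_def by blast
  then show ?thesis
    unfolding T using twisted_in_gforms[OF assms(5,3)] twisted_squared[OF assms(5,6,3,4)] assms(2)
    by simp
qed

end
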